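(* Let $n\geq 1$ be an integer. (i) Every operator $L$ of type $DN_{\infty,1}$ (with $N=n$) satisfies $L^\vee=(-1)^nL$. (ii) The operators of type $DN_{\infty,1}$ (with $N=n$) are precisely the differential operators of the form $$(t\partial_t)^{n}t + \sum_{p = 1}^{n + 1} g_p(t\partial_t)\,\partial_t^{p-1},$$ where each $g_p\in\mathbb{C}[x]$ is a polynomial of degree $\leq n-p+1$ that satisfies $g_p(x)=(-1)^{n-p+1}g_p(-x-p)$. (iii) Every operator $L$ of type $DN_{0,0}$ (with $N=n$) satisfies $L^\vee=(-1)^n\,wLw^{-1}$. (iv) The operators of type $DN_{0,0}$ (with $N=n$) are precisely the differential operators of the form $$(w\partial_w)^n + \sum_{p = 1}^{n + 1} w^p\,G_p(w\partial_w)\prod_{l=1}^{p-1}(w\partial_w+l),$$ where each $G_p\in\mathbb{C}[x]$ is a polynomial of degree $\leq n-p+1$ that satisfies $G_p(x)=(-1)^{n-p+1}G_p(-x-p)$.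
   Context: Matrices of size $n+1$ have rows and columns indexed by $0,\ldots,n$. The right determinant of a square matrix $M=(M_{ij})_{0\leq i,j\leq n}$ over an associative unital ring is $\det_{\mathrm{right}}(M)=\sum_\sigma \mathrm{sign}(\sigma)M_{\sigma(n),n}\cdots M_{\sigma(0),0}$, the sum over all permutations $\sigma$ of $\{0,\ldots,n\}$. Let $\mathbb{C}[t,\partial_t]$ be the Weyl algebra, $\partial_t=d/dt$. Let $A=(a_{ij})_{0\leq i,j\leq n}$ be a complex matrix with $a_{ij}=0$ if $i-j>1$ and $a_{ij}=1$ if $i-j=1$. Let $\tilde A$ be the matrix with $(i,j)$-entry $a_{ij}\partial_t^{\,j-i+1}$ (and $0$ if $i>j+1$). The operator $\det_{\mathrm{right}}(t\partial_t-\tilde A)$, where $t\partial_t$ stands for $t\partial_t$ times the identity matrix, is uniquely divisible on the right by $\partial_t$, and $L_{A,\infty}:=\det_{\mathrm{right}}(t\partial_t-\tilde A)\,\partial_t^{-1}\in\mathbb{C}[t,\partial_t]$ denotes the quotient. It can be written uniquely as $(t\partial_t)^nt+\sum_{p=1}^{n+1}g_p(t\partial_t)\partial_t^{p-1}$ with $g_p$ polynomials of degree $\leq n-p+1$. With these $g_p$ define, in $\mathbb{C}[w,w^{-1},\partial_w]$, $\partial_w=d/dw$, $$L_{A,0}=(w\partial_w)^n+\sum_{p=1}^{n+1}(-1)^ng_p(-w\partial_w)(-w^2\partial_w)^{p-1}w;$$ equivalently, the substitution $t=w^{-1}$, $\partial_t=-w^2\partial_w$ transforms $L_{A,\infty}$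 into $(-1)^nL_{A,0}w^{-1}$. Let $A^\tau$ be the matrix with $(i,j)$-entry $a_{n-j,n-i}$. $L_{A,\infty}$ is said to be of type $DN_{\infty,1}$, and $L_{A,0}$ of type $DN_{0,0}$, if $A=A^\tau$; here $N=n$. $L\mapsto L^\vee$ is the $\mathbb{C}$-linear anti-involution with $t^\vee=t$, $\partial_t^\vee=-\partial_t$ on $\mathbb{C}[t,\partial_t]$. It is extended to $\mathbb{C}[t,t^{-1},\partial_t]=\mathbb{C}[w,w^{-1},\partial_w]$ via $t=w^{-1}$, $\partial_t=-w^2\partial_w$; so $w^\vee=w$ and $(w^2\partial_w)^\vee=-w^2\partial_w$, i.e. $\partial_w^\vee=-w^2\partial_w w^{-2}$. *)

theory Defs
  imports
    "HOL-Computational_Algebra.Formal_Laurent_Series"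
    "HOL-Computational_Algebra.Polynomial"
    "HOL-Combinatorics.Permutations"
begin

section \<open>The ring of differential operators\<close>

text \<open>
  The ring \<open>\<complex>[t, t\<^sup>-\<^sup>1, \<partial>\<^sub>t]\<close> is realised as the \<open>\<complex>\<close>-algebra of operators on
  \<open>\<complex>((t))\<close> generated by multiplication with \<open>t\<close> and \<open>t\<^sup>-\<^sup>1\<close> and by the derivation
  \<open>\<partial>\<^sub>t = d/dt\<close>; in characteristic zero this representation is faithful.
\<close>

inductive_set diff_ops :: "(complex fls \<Rightarrow> complex fls) set" where
  scalar: "(\<lambda>f. fls_const c * f) \<in> diff_ops"
| mult_t: "(\<lambda>f. fls_X * f) \<in> diff_ops"
| mult_t_inv: "(\<lambda>f. fls_X_inv * f) \<in> diff_ops"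
| deriv: "fls_deriv \<in> diff_ops"
| add: "F \<in> diff_ops \<Longrightarrow> G \<in> diff_ops \<Longrightarrow> (\<lambda>f. F f + G f) \<in> diff_ops"
| comp: "F \<in> diff_ops \<Longrightarrow> G \<in> diff_ops \<Longrightarrow> (\<lambda>f. F (G f)) \<in> diff_ops"

lemma diff_ops_add: "F \<in> diff_ops \<Longrightarrow> F (f + g) = F f + F g"
  by (induction F arbitrary: f g rule: diff_ops.induct) (simp_all add: algebra_simps)

typedef diff_op = diff_ops
  morphisms app_op Abs_diff_op
  using diff_ops.deriv by blast

setup_lifting type_definition_diff_op

instantiation diff_op :: ring_1
begin

lift_definition zero_diff_op :: diff_op is "\<lambda>f. 0"
proof -
  have "(\<lambda>f. 0) = (\<lambda>f :: complex fls. fls_const 0 * f)" by auto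
  thus "(\<lambda>f. 0) \<in> diff_ops" using diff_ops.scalar[of 0] by metis
qed

lift_definition one_diff_op :: diff_op is "\<lambda>f. f"
proof -
  have "(\<lambda>f. f) = (\<lambda>f :: complex fls. fls_const 1 * f)" by auto
  thus "(\<lambda>f. f) \<in> diff_ops" using diff_ops.scalar[of 1] by metis
qed

lift_definition plus_diff_op :: "diff_op \<Rightarrow> diff_op \<Rightarrow> diff_op" is "\<lambda>F G f. F f + G f"
  by (rule diff_ops.add)

lift_definition times_diff_op :: "diff_op \<Rightarrow> diff_op \<Rightarrow> diff_op" is "\<lambda>F G f. F (G f)"
  by (rule diff_ops.comp)

lift_definition uminus_diff_op :: "diff_op \<Rightarrow> diff_op" is "\<lambda>F f. - F f"
  using diff_ops.comp[OF diff_ops.scalar[of "-1"]] by simp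

lift_definition minus_diff_op :: "diff_op \<Rightarrow> diff_op \<Rightarrow> diff_op" is "\<lambda>F G f. F f - G f"
  using diff_ops.add[OF _ diff_ops.comp[OF diff_ops.scalar[of "-1"]]] by simp

instance
proof
  show "(0 :: diff_op) \<noteq> 1"
    by transfer (metis one_neq_zero)
qed (transfer; force simp: diff_ops_add)+

end

lift_definition cst :: "complex \<Rightarrow> diff_op" is "\<lambda>c f. fls_const c * f"
  by (rule diff_ops.scalar)

lift_definition t :: diff_op is "\<lambda>f. fls_X * f"
  by (rule diff_ops.mult_t)

lift_definition t_inv :: diff_op is "\<lambda>f. fls_X_inv * f"
  by (rule diff_ops.mult_t_inv)

lift_definition dt :: diff_op is fls_deriv
  by (rule diff_ops.deriv)

text \<open>The coordinate \<open>w = t\<^sup>-\<^sup>1\<close> at infinity, so that \<open>w\<^sup>-\<^sup>1 = t\<close> and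
  \<open>\<complex>[w, w\<^sup>-\<^sup>1, \<partial>\<^sub>w]\<close> is the same ring.\<close>

definition w :: diff_op where "w = t_inv"
definition w_inv :: diff_op where "w_inv = t"
definition dw :: diff_op where "dw = - (t^2 * dt)"

lemma t_t_inv [simp]: "t * t_inv = 1" "t_inv * t = 1"
  by (transfer, simp add: mult.assoc[symmetric] fls_X_times_conv_shift fls_X_inv_times_conv_shift)+

lemma w_w_inv [simp]: "w * w_inv = 1" "w_inv * w = 1"
  by (simp_all add: w_def w_inv_def)

lemma dt_t: "dt * t = t * dt + 1"
  by (transfer) (auto simp: add.commute)

lemma dt_eq_dw: "dt = - (w^2 * dw)"
proof -
  have "w^2 * dw = - (t_inv * (t_inv * t) * t * dt)"
    by (simp only: w_def dw_def power2_eq_square mult.assoc mult_minus_right)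
  thus ?thesis by simp
qed

lemma dw_w: "dw * w = w * dw + 1"
proof -
  have dt_t_inv: "dt * t_inv = t_inv * dt - t_inv * t_inv"
    by transfer (auto simp: power2_eq_square algebra_simps)
  have "dw * w = - (t * t * (dt * t_inv))"
    by (simp add: w_def dw_def power2_eq_square mult.assoc)
  also have "\<dots> = - (t * (t * t_inv) * dt - t * (t * t_inv) * t_inv)"
    by (simp only: dt_t_inv right_diff_distrib mult.assoc)
  also have "\<dots> = - (t_inv * t * t * dt) + 1"
    by simp
  also have "\<dots> = w * dw + 1"
    by (simp only: w_def dw_def power2_eq_square mult.assoc mult_minus_right)
  finally show ?thesis .
qed

inductive_set weyl :: "diff_op set" where
  scalar: "cst c \<in> weyl"
| t: "t \<in> weyl"
| dt: "dt \<in> weyl"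
| add: "X \<in> weyl \<Longrightarrow> Y \<in> weyl \<Longrightarrow> X + Y \<in> weyl"
| mult: "X \<in> weyl \<Longrightarrow> Y \<in> weyl \<Longrightarrow> X * Y \<in> weyl"

lemma diff_op_induct [case_names scalar t t_inv dt add mult]:
  assumes "\<And>c. P (cst c)" "P t" "P t_inv" "P dt"
    and "\<And>X Y. P X \<Longrightarrow> P Y \<Longrightarrow> P (X + Y)" "\<And>X Y. P X \<Longrightarrow> P Y \<Longrightarrow> P (X * Y)"
  shows "P X"
proof -
  have "P (Abs_diff_op F)" if "F \<in> diff_ops" for F
    using that
  proof (induction rule: diff_ops.induct)
    case (add F G)
    thus ?case using assms(5)[OF add.IH] by (simp add: plus_diff_op_def Abs_diff_op_inverse)
  next
    case (comp F G)
    thus ?case using assms(6)[OF comp.IH] by (simp add: times_diff_op_def Abs_diff_op_inverse)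
  qed (use assms in \<open>simp_all add: cst_def t_def t_inv_def dt_def\<close>)
  thus ?thesis by (metis app_op app_op_inverse)
qed

lemma cst_commute: "cst c * X = X * cst c"
proof (induction X rule: diff_op_induct)
  case (add X Y)
  thus ?case by (simp add: distrib_left distrib_right)
next
  case (mult X Y)
  have "cst c * (X * Y) = X * cst c * Y" by (simp only: mult.assoc[symmetric] mult)
  also have "\<dots> = X * Y * cst c" by (simp only: mult.assoc mult)
  finally show ?case .
next
  case dt
  show ?case by transfer simp
qed (transfer; simp add: mult.left_commute)+

definition poly_op :: "complex poly \<Rightarrow> diff_op \<Rightarrow> diff_op" where
  "poly_op p X = (\<Sum>i\<le>degree p. cst (coeff p i) * X ^ i)"


section \<open>The anti-involution\<close>

definition is_anti_involution :: "(diff_op \<Rightarrow> diff_op) \<Rightarrow> bool" where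
  "is_anti_involution J \<longleftrightarrow>
     (\<forall>X Y. J (X + Y) = J X + J Y) \<and>
     (\<forall>c X. J (cst c * X) = cst c * J X) \<and>
     (\<forall>X Y. J (X * Y) = J Y * J X) \<and>
     (\<forall>X. J (J X) = X)"

text \<open>The extension of \<open>L \<mapsto> L\<^sup>\<or>\<close> from \<open>\<complex>[t, \<partial>\<^sub>t]\<close> to \<open>\<complex>[t, t\<^sup>-\<^sup>1, \<partial>\<^sub>t]\<close>.\<close>

definition dual :: "diff_op \<Rightarrow> diff_op" where
  "dual = (THE J. is_anti_involution J \<and> J t = t \<and> J dt = - dt)"

lemma anti_involution_1: "is_anti_involution J \<Longrightarrow> J 1 = 1"
  unfolding is_anti_involution_def by (metis mult_1 mult_1_right)

lemma anti_involution_cst: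
  assumes "is_anti_involution J" shows "J (cst c) = cst c"
proof -
  have "J (cst c * 1) = cst c * J 1"
    using assms unfolding is_anti_involution_def by blast
  thus ?thesis by (simp add: anti_involution_1[OF assms])
qed

lemma anti_involution_unique:
  assumes J: "is_anti_involution J" "J t = t" "J dt = - dt"
    and K: "is_anti_involution K" "K t = t" "K dt = - dt"
  shows "J X = K X"
proof (induction X rule: diff_op_induct)
  case (scalar c)
  show ?case using J(1) K(1) by (simp add: anti_involution_cst)
next
  case t_inv
  have *: "H t_inv = t_inv" if "is_anti_involution H" "H t = t" for H
  proof -
    have "H (t * t_inv) = H t_inv * H t"
      using that unfolding is_anti_involution_def by blast
    hence "H t_inv * t = 1"
      using that by (simp add: anti_involution_1)
    hence "H t_inv * (t * t_inv) = t_inv"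
      by (simp only: mult.assoc[symmetric] mult_1)
    thus ?thesis by simp
  qed
  show ?case using * J K by metis
qed (use J K in \<open>auto simp: is_anti_involution_def\<close>)

text \<open>Existence: transpose with respect to the residue pairing \<open>Res(f g dt)\<close>.\<close>

lemma fls_eq_if_residue_eq:
  fixes f g :: "complex fls"
  assumes "\<And>h. fls_residue (h * f) = fls_residue (h * g)"
  shows "f = g"
  by (rule fls_eqI) (metis assms fls_residue_shift_nth)

definition transposes :: "diff_op \<Rightarrow> diff_op \<Rightarrow> bool" where
  "transposes X Y \<longleftrightarrow> (\<forall>f g. fls_residue (app_op X f * g) = fls_residue (f * app_op Y g))"

lemma transposes_unique: "transposes X Y \<Longrightarrow> transposes X Z \<Longrightarrow> Y = Z"
  unfolding transposes_def
  by (metis app_op_inject ext fls_eq_if_residue_eq)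

lemma transposes_sym: "transposes X Y \<Longrightarrow> transposes Y X"
  unfolding transposes_def by (metis mult.commute)

lemma transposes_add: "transposes X Y \<Longrightarrow> transposes X' Y' \<Longrightarrow> transposes (X + X') (Y + Y')"
  unfolding transposes_def by (simp add: plus_diff_op.rep_eq algebra_simps)

lemma transposes_mult: "transposes X Y \<Longrightarrow> transposes X' Y' \<Longrightarrow> transposes (X * X') (Y' * Y)"
  unfolding transposes_def by (simp add: times_diff_op.rep_eq)

lemma transposes_cst: "transposes (cst c) (cst c)"
  unfolding transposes_def by (simp add: cst.rep_eq algebra_simps)

lemma transposes_t: "transposes t t"
  unfolding transposes_def by (simp add: t.rep_eq algebra_simps)

lemma transposes_t_inv: "transposes t_inv t_inv"
  unfolding transposes_def by (simp add: t_inv.rep_eq algebra_simps)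

lemma transposes_dt: "transposes dt (- dt)"
  unfolding transposes_def
  using fls_residue_times_deriv[where 'a = complex]
  by (simp del: fls_residue_def add: dt.rep_eq uminus_diff_op.rep_eq)
     (simp add: fls_residue_def)

lemma transposes_exists: "\<exists>Y. transposes X Y"
  by (induction X rule: diff_op_induct)
     (use transposes_cst transposes_t transposes_t_inv transposes_dt
        transposes_add transposes_mult in blast)+

lemma dual_ex1: "\<exists>!J. is_anti_involution J \<and> J t = t \<and> J dt = - dt"
proof (rule ex_ex1I)
  obtain J where J: "\<And>X. transposes X (J X)"
    using transposes_exists by metis
  have eq: "J X = Y" if "transposes X Y" for X Y
    using transposes_unique[OF J that] .
  have "is_anti_involution J"
    unfolding is_anti_involution_def
  proof (intro conjI allI)
    fix X Y c
    show "J (X + Y) = J X + J Y" by (intro eq transposes_add J)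
    show "J (X * Y) = J Y * J X" by (intro eq transposes_mult J)
    show "J (J X) = X" by (rule eq[OF transposes_sym[OF J]])
    have "cst c * J X = J X * cst c"
    proof (rule transposes_unique)
      show "transposes (X * cst c) (cst c * J X)"
        by (intro transposes_mult J transposes_cst)
      show "transposes (X * cst c) (J X * cst c)"
        unfolding cst_commute[of c X, symmetric] by (intro transposes_mult J transposes_cst)
    qed
    moreover have "J (cst c * X) = J X * cst c"
      by (intro eq transposes_mult J transposes_cst)
    ultimately show "J (cst c * X) = cst c * J X" by simp
  qed
  moreover have "J t = t" "J dt = - dt"
    using eq transposes_t transposes_dt by auto
  ultimately show "\<exists>J. is_anti_involution J \<and> J t = t \<and> J dt = - dt" by blast
next
  show "J = K" if "is_anti_involution J \<and> J t = t \<and> J dt = - dt"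
    and "is_anti_involution K \<and> K t = t \<and> K dt = - dt" for J K
    using that anti_involution_unique by (intro ext) blast
qed

lemma dual_props: "is_anti_involution dual" "dual t = t" "dual dt = - dt"
  using theI'[OF dual_ex1] unfolding dual_def by blast+


section \<open>Determinantal operators\<close>

text \<open>Matrices of size \<open>n + 1\<close> are functions on indices, of which only the values at
  \<open>i, j \<le> n\<close> are relevant.\<close>

definition det_right :: "nat \<Rightarrow> (nat \<Rightarrow> nat \<Rightarrow> 'a :: ring_1) \<Rightarrow> 'a" where
  "det_right n M = (\<Sum>\<sigma> | \<sigma> permutes {0..n}.
     of_int (sign \<sigma>) * prod_list (map (\<lambda>j. M (\<sigma> j) j) (rev [0..<Suc n])))"

definition admissible :: "nat \<Rightarrow> (nat \<Rightarrow> nat \<Rightarrow> complex) \<Rightarrow> bool" where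
  "admissible n A \<longleftrightarrow>
     (\<forall>i\<le>n. \<forall>j\<le>n. (i > j + 1 \<longrightarrow> A i j = 0) \<and> (i = j + 1 \<longrightarrow> A i j = 1))"

definition mat_tilde :: "(nat \<Rightarrow> nat \<Rightarrow> complex) \<Rightarrow> nat \<Rightarrow> nat \<Rightarrow> diff_op" where
  "mat_tilde A i j = (if i > j + 1 then 0 else cst (A i j) * dt ^ (j + 1 - i))"

definition det_op :: "nat \<Rightarrow> (nat \<Rightarrow> nat \<Rightarrow> complex) \<Rightarrow> diff_op" where
  "det_op n A = det_right n (\<lambda>i j. (if i = j then t * dt else 0) - mat_tilde A i j)"

definition L_inf :: "nat \<Rightarrow> (nat \<Rightarrow> nat \<Rightarrow> complex) \<Rightarrow> diff_op" where
  "L_inf n A = (THE L. L \<in> weyl \<and> L * dt = det_op n A)"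

text \<open>The polynomials \<open>g\<^sub>1, \<dots>, g\<^sub>n\<^sub>+\<^sub>1\<close> of the normal form; the requirement that the other members
  of the family vanish only serves to make the family unique as a function on \<open>nat\<close>.\<close>

definition g_coeffs :: "nat \<Rightarrow> (nat \<Rightarrow> nat \<Rightarrow> complex) \<Rightarrow> nat \<Rightarrow> complex poly" where
  "g_coeffs n A = (THE g.
     (\<forall>p. p \<notin> {1..n+1} \<longrightarrow> g p = 0) \<and>
     (\<forall>p\<in>{1..n+1}. degree (g p) \<le> n + 1 - p) \<and>
     L_inf n A = (t * dt) ^ n * t + (\<Sum>p=1..n+1. poly_op (g p) (t * dt) * dt ^ (p - 1)))"

definition L_zero :: "nat \<Rightarrow> (nat \<Rightarrow> nat \<Rightarrow> complex) \<Rightarrow> diff_op" where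
  "L_zero n A = (w * dw) ^ n +
     (\<Sum>p=1..n+1. (-1) ^ n * poly_op (g_coeffs n A p) (- (w * dw)) * (- (w^2 * dw)) ^ (p - 1) * w)"

definition mat_tau :: "nat \<Rightarrow> (nat \<Rightarrow> nat \<Rightarrow> complex) \<Rightarrow> nat \<Rightarrow> nat \<Rightarrow> complex" where
  "mat_tau n A i j = A (n - j) (n - i)"

definition tau_symmetric :: "nat \<Rightarrow> (nat \<Rightarrow> nat \<Rightarrow> complex) \<Rightarrow> bool" where
  "tau_symmetric n A \<longleftrightarrow> (\<forall>i\<le>n. \<forall>j\<le>n. A i j = mat_tau n A i j)"

definition type_DN_inf_1 :: "nat \<Rightarrow> diff_op set" where
  "type_DN_inf_1 n = {L_inf n A | A. admissible n A \<and> tau_symmetric n A}"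

definition type_DN_0_0 :: "nat \<Rightarrow> diff_op set" where
  "type_DN_0_0 n = {L_zero n A | A. admissible n A \<and> tau_symmetric n A}"

text \<open>Here \<open>degree 0 = 0\<close>, so the degree bound admits \<open>g\<^sub>p = 0\<close> for every \<open>p\<close>.\<close>

definition symmetric_family :: "nat \<Rightarrow> (nat \<Rightarrow> complex poly) \<Rightarrow> bool" where
  "symmetric_family n g \<longleftrightarrow> (\<forall>p\<in>{1..n+1}.
     degree (g p) \<le> n + 1 - p \<and>
     (\<forall>x. poly (g p) x = (-1) ^ (n + 1 - p) * poly (g p) (- x - of_nat p)))"

end

theory Submission imports Defs
begin

text \<open>
  Write \<open>\<theta> = t \<partial>\<^sub>t\<close>.  The matrix \<open>\<theta> - \<tilde>A\<close> has \<open>-1\<close> below the diagonal and \<open>0\<close> further down, so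
  only the permutations that shift along consecutive intervals contribute to its right determinant,
  which becomes a sum over all ways of cutting \<open>{0..n}\<close> into intervals \<open>[i..j]\<close>, of the product of the
  entries at \<open>(i, j)\<close>, later intervals standing to the left (\<open>det_right_hessenberg\<close>).  Such a sum can be
  built up from either end (\<open>hess_left_eq_hess_right_flip\<close>), and this is what duality exploits: it
  reverses the products, and the reversed sum of intervals is the one that belongs to \<open>A\<^sup>\<tau>\<close>.  As
  \<open>\<theta>\<^sup>\<or> = -(\<theta> + 1)\<close>, as \<open>\<partial>\<^sub>t\<^sup>\<or> = -\<partial>\<^sub>t\<close> and as \<open>(\<theta> + 1) \<partial>\<^sub>t = \<partial>\<^sub>t \<theta>\<close>, the dual of the entry at \<open>(i, j)\<close>, moved past
  a factor \<open>\<partial>\<^sub>t\<close>, is that entry again up to the sign \<open>(-1)\<^sup>j\<^sup>-\<^sup>i\<^sup>+\<^sup>1\<close>.  After cancelling \<open>\<partial>\<^sub>t\<close> on both sides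
  one gets, for every \<open>A\<close>,
  \<open>L\<^sub>A\<^sup>\<or> = (-1)\<^sup>n L\<close> with \<open>L\<close> the operator of \<open>A\<^sup>\<tau>\<close> (\<open>dual_L_inf\<close>), and (i) is the case \<open>A = A\<^sup>\<tau>\<close>.

  For (ii), taking duals in the normal form \<open>\<theta>\<^sup>n t + \<Sum> g\<^sub>p(\<theta>) \<partial>\<^sub>t\<^sup>p\<^sup>-\<^sup>1\<close> shows that \<open>L\<^sup>\<or> = (-1)\<^sup>n L\<close> holds if
  and only if the \<open>g\<^sub>p\<close> have the stated symmetry (\<open>dual_normal_form_eq_iff\<close>); this uses that the \<open>g\<^sub>p\<close>
  are determined by the operator.  It remains to see that \<open>A \<mapsto> (g\<^sub>p)\<close> is a bijection onto the families
  with \<open>deg g\<^sub>p \<le> n - p + 1\<close>, for then a symmetric family belongs to a matrix \<open>A\<close> such that \<open>A\<close> and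
  \<open>A\<^sup>\<tau>\<close> have the same operator, whence \<open>A = A\<^sup>\<tau>\<close>.  Bijectivity is triangular with respect to the
  diagonals: the diagonals \<open>j - i < q\<close> determine \<open>g\<^sub>1, \<dots>, g\<^sub>q\<close>, and changing the next diagonal changes
  \<open>g\<^sub>q\<^sub>+\<^sub>1\<close> by a combination, with minus the changes as coefficients, of the polynomials
  \<open>x\<^sup>i (x + q + 1)\<^sup>n\<^sup>-\<^sup>q\<^sup>-\<^sup>i\<close>, which form a basis of the polynomials of degree \<open>\<le> n - q\<close>
  (\<open>hess_coeff_first_difference\<close>, \<open>weighted_poly_basis_exists\<close>).

  Parts (iii) and (iv) are (i) and (ii) rewritten through the identity \<open>L\<^sub>A\<^sub>,\<^sub>0 = (-1)\<^sup>n L\<^sub>A\<^sub>,\<^sub>\<infinity> w\<close>; moving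
  \<open>w\<^sup>p\<close> to the left replaces \<open>g\<^sub>p(x)\<close> by \<open>\<plusminus>g\<^sub>p(-x - p)\<close>, which for a symmetric family is \<open>g\<^sub>p\<close> again, so the
  same family serves at both ends.
\<close>

unbundle fps_syntax

section \<open>Right determinants of Hessenberg matrices\<close>

text \<open>
  Both functions sum, over all ways of cutting \<open>{0..<m}\<close> into intervals \<open>[i..j]\<close>, the product of the
  \<open>b i j\<close>.  The factors of later intervals stand to the left in the first sum and to the right in the
  second; the recursion splits off the last interval.
\<close>

function hess_left :: "(nat \<Rightarrow> nat \<Rightarrow> 'a :: ring_1) \<Rightarrow> nat \<Rightarrow> 'a" where
  "hess_left b 0 = 1"
| "hess_left b (Suc m) = (\<Sum>i\<le>m. b i m * hess_left b i)"
  by pat_completeness auto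
termination by (relation "measure snd") auto

function hess_right :: "(nat \<Rightarrow> nat \<Rightarrow> 'a :: ring_1) \<Rightarrow> nat \<Rightarrow> 'a" where
  "hess_right b 0 = 1"
| "hess_right b (Suc m) = (\<Sum>i\<le>m. hess_right b i * b i m)"
  by pat_completeness auto
termination by (relation "measure snd") auto

lemma hess_right_cong:
  "(\<And>i j. i \<le> j \<Longrightarrow> j < m \<Longrightarrow> b i j = b' i j) \<Longrightarrow> hess_right b m = hess_right b' m"
proof (induction m rule: less_induct)
  case (less m)
  show ?case
  proof (cases m)
    case (Suc l)
    have "hess_right b i = hess_right b' i" if "i \<le> l" for i
      using that less.prems Suc by (intro less.IH) auto
    thus ?thesis using less.prems by (auto simp: Suc intro!: sum.cong)
  qed simp
qed

text \<open>
  The right-hand side builds up the same sum from the first interval instead of the last one.  With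
  \<open>d k\<close> the sum over cuttings of \<open>{0..<k}\<close> and \<open>F k\<close> the one over cuttings of \<open>{k..n}\<close>, expand
  \<open>\<Sum>k\<le>n. F k * d k\<close> by the recursion of \<open>F\<close>, collect by that of \<open>d\<close>, and the sum comes back with
  indices shifted by one.  So only the boundary terms \<open>F 0\<close> and \<open>d (n + 1)\<close> are left.
\<close>
lemma hess_left_eq_hess_right_flip:
  "hess_left b (Suc n) = hess_right (\<lambda>i j. b (n - j) (n - i)) (Suc n)"
proof -
  \<comment> \<open>\<open>F k\<close> sums over the cuttings of \<open>{k..n}\<close>; the index runs backwards.\<close>
  define F where "F k = hess_right (\<lambda>i j. b (n - j) (n - i)) (Suc n - k)" for k
  define d where "d = hess_left b"
  have F: "F k = (\<Sum>j=k..n. F (Suc j) * b k j)" if "k \<le> n" for k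
  proof -
    have "F k = (\<Sum>i\<le>n - k. F (Suc (n - i)) * b k (n - i))"
      using that by (auto simp: F_def Suc_diff_le intro!: sum.cong)
    also have "\<dots> = (\<Sum>j=k..n. F (Suc j) * b k j)"
      using that by (intro sum.reindex_bij_witness[of _ "\<lambda>j. n - j" "\<lambda>i. n - i"]) auto
    finally show ?thesis .
  qed
  have "(\<Sum>k\<le>n. F k * d k) = (\<Sum>k\<le>n. \<Sum>j\<in>{k..n}. F (Suc j) * b k j * d k)"
    by (intro sum.cong refl) (simp add: F sum_distrib_right)
  also have "\<dots> = (\<Sum>j\<le>n. \<Sum>k\<le>j. F (Suc j) * b k j * d k)"
    unfolding sum.Sigma[OF finite_atMost ballI[OF finite_atLeastAtMost]] sum.Sigma[OF finite_atMost ballI[OF finite_atMost]]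
    by (intro sum.reindex_bij_witness[of _ "\<lambda>(j, k). (k, j)" "\<lambda>(j, k). (k, j)"]) auto
  also have "\<dots> = (\<Sum>j\<le>n. F (Suc j) * d (Suc j))"
    by (simp add: d_def sum_distrib_left mult.assoc)
  finally have "(\<Sum>k\<le>n. F k * d k) = (\<Sum>j\<le>n. F (Suc j) * d (Suc j))" .
  moreover have "F 0 * d 0 + (\<Sum>j\<le>n. F (Suc j) * d (Suc j)) = (\<Sum>k\<le>n. F k * d k) + F (Suc n) * d (Suc n)"
    using sum.atMost_Suc_shift[of "\<lambda>k. F k * d k" n] by simp
  ultimately have "F 0 * d 0 = F (Suc n) * d (Suc n)" by simp
  thus ?thesis by (simp add: F_def d_def)
qed

text \<open>
  The right determinant of the submatrix with rows and columns \<open>k..n\<close>, so that expanding along the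
  first column needs no renumbering of the remaining ones.
\<close>
definition column_det :: "nat \<Rightarrow> nat \<Rightarrow> (nat \<Rightarrow> nat \<Rightarrow> 'a :: ring_1) \<Rightarrow> 'a" where
  "column_det k n M = (\<Sum>\<sigma> | \<sigma> permutes {k..n}.
     of_int (sign \<sigma>) * prod_list (map (\<lambda>j. M (\<sigma> j) j) (rev [k..<Suc n])))"

lemma column_det_cong:
  assumes "\<And>i j. i \<in> {k..n} \<Longrightarrow> j \<in> {k..n} \<Longrightarrow> M i j = N i j"
  shows "column_det k n M = column_det k n N"
proof -
  have "map (\<lambda>j. M (\<sigma> j) j) (rev [k..<Suc n]) = map (\<lambda>j. N (\<sigma> j) j) (rev [k..<Suc n])"
    if "\<sigma> permutes {k..n}" for \<sigma>
    using permutes_in_image[OF that] by (auto intro!: assms simp del: upt_Suc)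
  thus ?thesis unfolding column_det_def by (metis (mono_tags, lifting) mem_Collect_eq sum.cong)
qed

lemma column_det_expand:
  assumes "k \<le> n"
  shows "column_det k n M =
    (\<Sum>b=k..n. (if b = k then 1 else - 1) * column_det (Suc k) n (\<lambda>i. M (transpose k b i)) * M b k)"
proof -
  have ins: "{k..n} = insert k {Suc k..n}" using assms by auto
  have list: "map f (rev [k..<Suc n]) = map f (rev [Suc k..<Suc n]) @ [f k]" for f :: "nat \<Rightarrow> 'a"
    using assms by (subst upt_conv_Cons) auto
  have summand: "of_int (sign (transpose k b \<circ> q)) *
      prod_list (map (\<lambda>j. M ((transpose k b \<circ> q) j) j) (rev [k..<Suc n])) =
      (if b = k then 1 else - 1) * (of_int (sign q) *
        prod_list (map (\<lambda>j. M (transpose k b (q j)) j) (rev [Suc k..<Suc n]))) * M b k"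
    if q: "q permutes {Suc k..n}" for b q
  proof -
    have "q k = k" using permutes_not_in[OF q] by simp
    moreover have "sign (transpose k b \<circ> q) = (if b = k then 1 else - 1) * sign q"
      using permutes_imp_permutation[OF _ q]
      by (simp add: sign_compose permutation_swap_id sign_swap_id)
    ultimately show ?thesis by (simp only: list) (simp add: mult.assoc)
  qed
  show ?thesis
    unfolding column_det_def ins sum_distrib_left sum_distrib_right
  proof (subst sum_over_permutations_insert, goal_cases)
    case 3
    show ?case
      by (rule sum.cong[OF refl], rule sum.cong[OF refl], rule summand) blast
  qed simp_all
qed

lemma column_det_0: "det_right n M = column_det 0 n M"
  by (simp add: det_right_def column_det_def)

lemma column_det_empty: "column_det (Suc n) n M = 1"
  by (simp add: column_det_def)

text \<open>
  Replacing row \<open>k\<close> by a row \<open>r \<le> k\<close> gives the statement an inductive form.  In the first column only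
  the entries in rows \<open>k\<close> and \<open>k + 1\<close> count.  The first one splits off an interval ending at \<open>k\<close>.  For the
  second one, the entry \<open>-1\<close> cancels the sign of the transposition, and after the transposition row
  \<open>k + 1\<close> holds row \<open>r\<close>: the interval that began at \<open>r\<close> is prolonged.
\<close>
lemma column_det_hessenberg:
  fixes M :: "nat \<Rightarrow> nat \<Rightarrow> 'a :: ring_1"
  assumes M: "\<And>i j. i \<le> n \<Longrightarrow> Suc j < i \<Longrightarrow> M i j = 0" "\<And>j. j < n \<Longrightarrow> M (Suc j) j = - 1"
    and "k \<le> n" "r \<le> k"
  shows "column_det k n (\<lambda>i. if i = k then M r else M i) =
    (\<Sum>j=k..n. column_det (Suc j) n M * M r j)"
  using assms(3,4)
proof (induction k rule: inc_induct)
  case base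
  show ?case by (subst column_det_expand) (simp_all add: column_det_empty)
next
  case (step k)
  define N where "N = (\<lambda>i. if i = k then M r else M i)"
  let ?T = "\<lambda>b. (if b = k then 1 else - 1) * column_det (Suc k) n (\<lambda>i. N (transpose k b i)) * N b k"
  have "column_det k n N = (\<Sum>b=k..n. ?T b)"
    using step by (intro column_det_expand) simp
  also have "\<dots> = (\<Sum>b\<in>{k, Suc k}. ?T b)"
    using step by (intro sum.mono_neutral_right ballI) (auto simp: N_def M(1))
  also have "\<dots> = column_det (Suc k) n N * M r k + column_det (Suc k) n (\<lambda>i. N (transpose k (Suc k) i))"
    using step M(2)[of k] by (simp add: N_def cong: if_cong)
  also have "column_det (Suc k) n N = column_det (Suc k) n M"
    by (intro column_det_cong) (simp add: N_def)
  also have "column_det (Suc k) n (\<lambda>i. N (transpose k (Suc k) i)) =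
      column_det (Suc k) n (\<lambda>i. if i = Suc k then M r else M i)"
    by (intro column_det_cong) (auto simp: N_def transpose_def)
  also have "\<dots> = (\<Sum>j=Suc k..n. column_det (Suc j) n M * M r j)"
    using step by simp
  also have "column_det (Suc k) n M * M r k + \<dots> = (\<Sum>j=k..n. column_det (Suc j) n M * M r j)"
    using step by (subst (2) sum.atLeast_Suc_atMost) simp_all
  finally show ?case by (simp add: N_def)
qed

lemma det_right_hessenberg:
  fixes M :: "nat \<Rightarrow> nat \<Rightarrow> 'a :: ring_1"
  assumes M: "\<And>i j. i \<le> n \<Longrightarrow> Suc j < i \<Longrightarrow> M i j = 0" "\<And>j. j < n \<Longrightarrow> M (Suc j) j = - 1"
  shows "det_right n M = hess_right (\<lambda>i j. M (n - j) (n - i)) (Suc n)"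
proof -
  have "column_det (Suc n - m) n M = hess_right (\<lambda>i j. M (n - j) (n - i)) m" if "m \<le> Suc n" for m
    using that
  proof (induction m rule: less_induct)
    case (less m)
    show ?case
    proof (cases m)
      case 0
      thus ?thesis by (simp add: column_det_empty)
    next
      case (Suc l)
      have "column_det (n - l) n M = column_det (n - l) n (\<lambda>i. if i = n - l then M (n - l) else M i)"
        by (intro column_det_cong) auto
      also have "\<dots> = (\<Sum>j=n-l..n. column_det (Suc j) n M * M (n - l) j)"
        using M by (intro column_det_hessenberg) auto
      also have "\<dots> = (\<Sum>i\<le>l. column_det (Suc n - i) n M * M (n - l) (n - i))"
        using less.prems Suc
        by (intro sum.reindex_bij_witness[of _ "\<lambda>i. n - i" "\<lambda>j. n - j"]) (auto simp: Suc_diff_le)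
      also have "\<dots> = (\<Sum>i\<le>l. hess_right (\<lambda>i j. M (n - j) (n - i)) i * M (n - l) (n - i))"
        using less Suc by (intro sum.cong refl) simp
      finally show ?thesis by (simp add: Suc)
    qed
  qed
  from this[of "Suc n"] show ?thesis by (simp add: column_det_0)
qed

section \<open>Operators and their action on monomials\<close>

lemma poly_eqI_nat:
  fixes p q :: "complex poly"
  assumes "\<And>x :: nat. poly p (of_nat x) = poly q (of_nat x)"
  shows "p = q"
proof (rule ccontr)
  assume "p \<noteq> q"
  hence "finite {x. poly (p - q) x = 0}" by (intro poly_roots_finite) simp
  moreover have "range (of_nat :: nat \<Rightarrow> complex) \<subseteq> {x. poly (p - q) x = 0}"
    using assms by auto
  ultimately show False
    using infinite_UNIV_nat finite_imageD[OF _ inj_of_nat] finite_subset by blast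
qed

text \<open>
  A Laurent series is not a finite combination of monomials, so this needs a reason: the coefficients
  of \<open>X\<^sup>\<or> g\<close>, for any series \<open>g\<close>, are residues of \<open>g\<close> times the images of monomials under \<open>X\<close>.  Hence the
  action of \<open>X\<close> on monomials determines \<open>X\<^sup>\<or>\<close>, and thereby \<open>X\<close>.
\<close>
lemma diff_op_eqI:
  assumes "\<And>k. app_op X (fls_X_intpow k) = app_op Y (fls_X_intpow k)"
  shows "X = Y"
proof -
  obtain X' Y' where T: "transposes X X'" "transposes Y Y'"
    using transposes_exists by blast
  have "app_op X' g $$ j = app_op Y' g $$ j" for g j
  proof -
    have "fls_residue (fls_X_intpow (- j - 1) * app_op X' g) = fls_residue (fls_X_intpow (- j - 1) * app_op Y' g)"
      using T assms unfolding transposes_def by metis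
    thus ?thesis unfolding fls_residue_shift_nth[of _ j] .
  qed
  hence "X' = Y'"
    by (metis app_op_inject ext fls_eqI)
  thus ?thesis using T transposes_sym transposes_unique by metis
qed

text \<open>
  The coefficient of \<open>t\<^sup>k\<^sup>+\<^sup>m\<close> in \<open>X t\<^sup>k\<close> is a polynomial in \<open>k\<close>, for each fixed \<open>m\<close>.
\<close>
definition polynomial_action :: "diff_op \<Rightarrow> bool" where
  "polynomial_action X \<longleftrightarrow>
     (\<forall>m. \<exists>p. \<forall>k. app_op X (fls_X_intpow k) $$ (k + m) = poly p (of_int k))"

text \<open>
  Left multiplication by a generator only rescales and shifts coefficients, so no control over the
  number of monomials in \<open>Y t\<^sup>k\<close> is required.  The arbitrary right factor is what lets an induction over
  products work.
\<close>
lemma polynomial_action_mult: "polynomial_action Y \<Longrightarrow> polynomial_action (X * Y)"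
proof (induction X arbitrary: Y rule: diff_op_induct)
  case (scalar c)
  show ?case unfolding polynomial_action_def
  proof
    fix m
    obtain p where p: "app_op Y (fls_X_intpow k) $$ (k + m) = poly p (of_int k)" for k
      using scalar unfolding polynomial_action_def by blast
    show "\<exists>p. \<forall>k. app_op (cst c * Y) (fls_X_intpow k) $$ (k + m) = poly p (of_int k)"
      by (intro exI[of _ "smult c p"]) (simp add: times_diff_op.rep_eq cst.rep_eq p)
  qed
next
  case t
  show ?case unfolding polynomial_action_def
  proof
    fix m
    obtain p where p: "app_op Y (fls_X_intpow k) $$ (k + (m - 1)) = poly p (of_int k)" for k
      using t unfolding polynomial_action_def by blast
    show "\<exists>p. \<forall>k. app_op (t * Y) (fls_X_intpow k) $$ (k + m) = poly p (of_int k)"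
      using p by (intro exI[of _ p]) (simp add: times_diff_op.rep_eq t.rep_eq fls_X_times_conv_shift algebra_simps)
  qed
next
  case t_inv
  show ?case unfolding polynomial_action_def
  proof
    fix m
    obtain p where p: "app_op Y (fls_X_intpow k) $$ (k + (m + 1)) = poly p (of_int k)" for k
      using t_inv unfolding polynomial_action_def by blast
    show "\<exists>p. \<forall>k. app_op (t_inv * Y) (fls_X_intpow k) $$ (k + m) = poly p (of_int k)"
      using p by (intro exI[of _ p]) (simp add: times_diff_op.rep_eq t_inv.rep_eq fls_X_inv_times_conv_shift algebra_simps)
  qed
next
  case dt
  show ?case unfolding polynomial_action_def
  proof
    fix m
    obtain p where p: "app_op Y (fls_X_intpow k) $$ (k + (m + 1)) = poly p (of_int k)" for k
      using dt unfolding polynomial_action_def by blast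
    have "app_op (dt * Y) (fls_X_intpow k) $$ (k + m) = poly ([:of_int m + 1, 1:] * p) (of_int k)" for k
      by (simp add: times_diff_op.rep_eq dt.rep_eq p[symmetric] algebra_simps)
    thus "\<exists>p. \<forall>k. app_op (dt * Y) (fls_X_intpow k) $$ (k + m) = poly p (of_int k)" by blast
  qed
next
  case (add X X')
  show ?case unfolding polynomial_action_def
  proof
    fix m
    obtain p q where p: "app_op (X * Y) (fls_X_intpow k) $$ (k + m) = poly p (of_int k)"
      and q: "app_op (X' * Y) (fls_X_intpow k) $$ (k + m) = poly q (of_int k)" for k
      using add.IH[OF add.prems] unfolding polynomial_action_def by metis
    show "\<exists>p. \<forall>k. app_op ((X + X') * Y) (fls_X_intpow k) $$ (k + m) = poly p (of_int k)"
      using p q by (intro exI[of _ "p + q"]) (simp add: distrib_right plus_diff_op.rep_eq)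
  qed
next
  case (mult X X')
  thus ?case by (simp add: mult.assoc)
qed

lemma polynomial_action: "polynomial_action X"
proof -
  have "polynomial_action 1"
    unfolding polynomial_action_def
  proof
    fix m :: int
    show "\<exists>p. \<forall>k. app_op 1 (fls_X_intpow k) $$ (k + m) = poly p (of_int k)"
      by (intro exI[of _ "if m = 0 then 1 else 0"]) (simp add: one_diff_op.rep_eq)
  qed
  from polynomial_action_mult[OF this, of X] show ?thesis by simp
qed

lemma dt_monomial: "app_op dt (fls_X_intpow k) = fls_const (of_int k) * fls_X_intpow (k - 1)"
proof (rule fls_eqI)
  fix j
  show "app_op dt (fls_X_intpow k) $$ j = (fls_const (of_int k) * fls_X_intpow (k - 1)) $$ j"
    by (cases "k = j + 1") (auto simp: dt.rep_eq)
qed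

lemma app_op_const_mult: "app_op X (fls_const c * f) = fls_const c * app_op X f"
  using arg_cong[OF cst_commute[of c X], of "\<lambda>Y. app_op Y f"]
  by (simp add: times_diff_op.rep_eq cst.rep_eq)

text \<open>
  The image of \<open>\<partial>\<^sub>t\<close> misses only the monomial \<open>t\<^sup>-\<^sup>1\<close>, so \<open>X\<close> kills all the others; as the coefficients
  of \<open>X t\<^sup>k\<close> depend polynomially on \<open>k\<close>, it kills \<open>t\<^sup>-\<^sup>1\<close> as well.
\<close>
lemma mult_dt_eq_0D:
  assumes "X * dt = 0"
  shows "X = 0"
proof (rule diff_op_eqI, rule fls_eqI)
  fix k l
  have zero: "app_op X (fls_X_intpow j) = 0" if "j \<noteq> - 1" for j
  proof -
    have "fls_const (of_int (j + 1)) * app_op X (fls_X_intpow j) = app_op (X * dt) (fls_X_intpow (j + 1))"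
      unfolding times_diff_op.rep_eq dt_monomial app_op_const_mult by simp
    also have "\<dots> = 0" by (simp add: assms zero_diff_op.rep_eq)
    finally show ?thesis using that by (simp flip: of_int_add add: add_eq_0_iff)
  qed
  obtain p where p: "app_op X (fls_X_intpow j) $$ (j + (l - k)) = poly p (of_int j)" for j
    using polynomial_action[of X] unfolding polynomial_action_def by metis
  have "p = 0"
  proof (rule poly_eqI_nat)
    fix x :: nat
    show "poly p (of_nat x) = poly 0 (of_nat x)"
      using p[of "int x"] by (simp add: zero)
  qed
  thus "app_op X (fls_X_intpow k) $$ l = app_op 0 (fls_X_intpow k) $$ l"
    using p[of k] by (simp add: zero_diff_op.rep_eq)
qed

lemma dual_add: "dual (X + Y) = dual X + dual Y"
  and dual_mult: "dual (X * Y) = dual Y * dual X"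
  and dual_dual: "dual (dual X) = X"
  using dual_props(1) unfolding is_anti_involution_def by blast+

lemma dual_cst: "dual (cst c) = cst c"
  and dual_1: "dual 1 = 1"
  using anti_involution_cst anti_involution_1 dual_props(1) by blast+

lemma dual_0: "dual 0 = 0"
  using dual_add[of 0 0] by simp

lemma dual_minus: "dual (- X) = - dual X"
  using dual_add[of X "- X"] dual_0 by (simp add: eq_neg_iff_add_eq_0 add.commute)

lemma dual_sum: "dual (\<Sum>i\<in>I. f i) = (\<Sum>i\<in>I. dual (f i))"
  by (induction I rule: infinite_finite_induct) (simp_all add: dual_0 dual_add)

lemma dual_power: "dual (X ^ k) = dual X ^ k"
  by (induction k) (simp_all add: dual_1 dual_mult power_commutes)

lemma dt_mult_eq_0D:
  assumes "dt * X = 0"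
  shows "X = 0"
proof -
  have "dual X * dt = - dual (dt * X)" by (simp add: dual_mult dual_props)
  hence "dual X = 0" using assms mult_dt_eq_0D dual_0 by simp
  thus ?thesis using dual_dual[of X] dual_0 by simp
qed

lemma cst_0: "cst 0 = 0" by transfer simp
lemma cst_1: "cst 1 = 1" by transfer simp
lemma cst_add: "cst (a + b) = cst a + cst b"
  by transfer (simp add: fun_eq_iff fls_plus_const[symmetric] distrib_right)
lemma cst_mult: "cst (a * b) = cst a * cst b"
  by transfer (simp add: fun_eq_iff mult.assoc flip: fls_const_mult_const)
lemma cst_minus: "cst (- a) = - cst a"
  using cst_add[of a "- a"] cst_0 by (simp add: eq_neg_iff_add_eq_0 add.commute)
lemma cst_of_nat: "cst (of_nat k) = of_nat k"
  by (induction k) (simp_all add: cst_0 cst_1 cst_add)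

section \<open>Evaluating polynomials at operators\<close>

lemma poly_op_bound:
  assumes "degree p \<le> N"
  shows "poly_op p X = (\<Sum>i\<le>N. cst (coeff p i) * X ^ i)"
  unfolding poly_op_def using assms
  by (intro sum.mono_neutral_left) (auto simp: cst_0 coeff_eq_0)

lemma poly_op_pCons: "poly_op (pCons a p) X = cst a + X * poly_op p X"
proof -
  have "poly_op (pCons a p) X = (\<Sum>i\<le>Suc (degree p). cst (coeff (pCons a p) i) * X ^ i)"
    by (intro poly_op_bound) (simp add: degree_pCons_le)
  also have "\<dots> = cst a + (\<Sum>i\<le>degree p. X * (cst (coeff p i) * X ^ i))"
    by (subst sum.atMost_Suc_shift) (simp add: cst_commute[of _ X] mult.assoc[symmetric] del: sum.atMost_Suc)
  finally show ?thesis by (simp add: poly_op_def sum_distrib_left)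
qed

lemma poly_op_0: "poly_op 0 X = 0"
  by (simp add: poly_op_def cst_0)

lemma poly_op_1: "poly_op 1 X = 1"
  by (simp add: poly_op_def cst_1)

lemma poly_op_add: "poly_op (p + q) X = poly_op p X + poly_op q X"
proof -
  define N where "N = max (degree p) (degree q)"
  have "degree (p + q) \<le> N" "degree p \<le> N" "degree q \<le> N"
    by (auto simp: N_def degree_add_le)
  thus ?thesis by (simp add: poly_op_bound cst_add distrib_right sum.distrib)
qed

lemma poly_op_smult: "poly_op (smult c p) X = cst c * poly_op p X"
  by (subst poly_op_bound[where N = "degree p"])
    (simp_all add: poly_op_def degree_smult_le cst_mult sum_distrib_left mult.assoc)

lemma poly_op_minus: "poly_op (- p) X = - poly_op p X"
  using poly_op_smult[of "- 1" p X] by (simp add: cst_minus cst_1)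

lemma poly_op_diff: "poly_op (p - q) X = poly_op p X - poly_op q X"
  using poly_op_add[of p "- q" X] by (simp add: poly_op_minus)

lemma poly_op_sum: "poly_op (\<Sum>i\<in>I. f i) X = (\<Sum>i\<in>I. poly_op (f i) X)"
  by (induction I rule: infinite_finite_induct) (simp_all add: poly_op_0 poly_op_add)

lemma poly_op_mult: "poly_op (p * q) X = poly_op p X * poly_op q X"
  by (induction p)
    (simp_all add: poly_op_0 poly_op_add poly_op_smult poly_op_pCons cst_0 distrib_right mult.assoc)

lemma poly_op_linear: "poly_op [:a, b:] X = cst a + cst b * X"
  by (simp add: poly_op_pCons poly_op_0 cst_commute)

lemma poly_op_pcompose: "poly_op (p \<circ>\<^sub>p q) X = poly_op p (poly_op q X)"
  by (induction p)
    (simp_all add: poly_op_0 pcompose_pCons poly_op_add poly_op_mult poly_op_pCons)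

lemma poly_op_intertwine:
  assumes "Z * X = Y * Z"
  shows "Z * poly_op p X = poly_op p Y * Z"
proof (induction p)
  case 0
  show ?case by (simp add: poly_op_0)
next
  case (pCons a p)
  have "Z * poly_op (pCons a p) X = Z * cst a + Z * X * poly_op p X"
    by (simp add: poly_op_pCons distrib_left mult.assoc)
  also have "\<dots> = cst a * Z + Y * (Z * poly_op p X)"
    by (simp add: cst_commute assms mult.assoc)
  also have "\<dots> = poly_op (pCons a p) Y * Z"
    by (simp add: poly_op_pCons distrib_right mult.assoc pCons)
  finally show ?case .
qed

lemma dual_poly_op: "dual (poly_op p X) = poly_op p (dual X)"
  by (simp add: poly_op_def dual_sum dual_mult dual_cst dual_power cst_commute)

lemma dt_power_theta: "dt ^ k * (t * dt) = (t * dt + of_nat k) * dt ^ k"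
proof (induction k)
  case (Suc k)
  have "dt ^ Suc k * (t * dt) = dt * (t * dt + of_nat k) * dt ^ k"
    by (simp add: Suc mult.assoc)
  also have "dt * (t * dt + of_nat k) = dt * t * dt + of_nat k * dt"
    by (simp only: distrib_left mult.assoc mult_of_nat_commute)
  also have "\<dots> = (t * dt + of_nat (Suc k)) * dt"
    by (simp add: dt_t distrib_right)
  finally show ?case by (simp add: mult.assoc)
qed simp

lemma dual_theta: "dual (t * dt) = - (t * dt) - 1"
  by (simp add: dual_mult dual_props dt_t)

lemma theta_monomial: "app_op (t * dt) (fls_X_intpow k) = fls_const (of_int k) * fls_X_intpow k"
  by (simp add: times_diff_op.rep_eq dt_monomial app_op_const_mult)
    (simp add: t.rep_eq fls_X_times_conv_shift)

lemma poly_op_theta_monomial: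
  "app_op (poly_op p (t * dt)) (fls_X_intpow k) = fls_const (poly p (of_int k)) * fls_X_intpow k"
proof (induction p)
  case 0
  show ?case by (simp add: poly_op_0 zero_diff_op.rep_eq)
next
  case (pCons a p)
  have "app_op (poly_op (pCons a p) (t * dt)) (fls_X_intpow k) =
    fls_const a * fls_X_intpow k + fls_const (poly p (of_int k)) * (fls_const (of_int k) * fls_X_intpow k)"
    unfolding poly_op_pCons plus_diff_op.rep_eq times_diff_op.rep_eq[of "t * dt"] pCons
      app_op_const_mult theta_monomial by (simp add: cst.rep_eq)
  thus ?case
    by (simp add: algebra_simps flip: fls_plus_const)
qed

lemma dt_power_monomial:
  "app_op (dt ^ j) (fls_X_intpow k) = fls_const (\<Prod>l<j. of_int (k - int l)) * fls_X_intpow (k - int j)"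
proof (induction j)
  case 0
  show ?case by (simp add: one_diff_op.rep_eq)
next
  case (Suc j)
  have "app_op (dt ^ Suc j) (fls_X_intpow k) =
    fls_const (\<Prod>l<j. of_int (k - int l)) * (fls_const (of_int (k - int j)) * fls_X_intpow (k - int j - 1))"
    unfolding power_Suc times_diff_op.rep_eq Suc app_op_const_mult dt_monomial ..
  thus ?case by (simp add: mult.assoc[symmetric] algebra_simps)
qed

lemma app_op_sum: "app_op (\<Sum>i\<in>I. X i) f = (\<Sum>i\<in>I. app_op (X i) f)"
  by (induction I rule: infinite_finite_induct) (simp_all add: zero_diff_op.rep_eq plus_diff_op.rep_eq)

section \<open>The normal form and its dual\<close>

text \<open>
  The coefficient of \<open>t\<^sup>x\<close> in the image of \<open>t\<^sup>x\<^sup>+\<^sup>q\<^sup>-\<^sup>1\<close> sees only the summand \<open>q\<close>, which contributes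
  \<open>h\<^sub>q(x)\<close> times a falling factorial that is nonzero for all natural \<open>x\<close>.
\<close>

lemma poly_op_theta_dt_independent:
  assumes "(\<Sum>p=1..n+1. poly_op (h p) (t * dt) * dt ^ (p - 1)) = 0" "q \<in> {1..n+1}"
  shows "h q = 0"
proof (rule poly_eqI_nat)
  fix x :: nat
  define k where "k = int x + int (q - 1)"
  define c :: "nat \<Rightarrow> complex" where "c p = (\<Prod>l<p-1. of_int (k - int l))" for p
  have summand: "app_op (poly_op (h p) (t * dt) * dt ^ (p - 1)) (fls_X_intpow k) $$ int x =
      (if p = q then c q * poly (h q) (of_nat x) else 0)" if "p \<in> {1..n+1}" for p
  proof -
    have "app_op (poly_op (h p) (t * dt) * dt ^ (p - 1)) (fls_X_intpow k) =
        fls_const (c p) * (fls_const (poly (h p) (of_int (k - int (p - 1)))) * fls_X_intpow (k - int (p - 1)))"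
      unfolding times_diff_op.rep_eq dt_power_monomial app_op_const_mult poly_op_theta_monomial c_def ..
    moreover have "k - int (q - 1) = int x"
      by (simp add: k_def)
    moreover have "k - int (p - 1) = int x \<longleftrightarrow> p = q"
      using that assms(2) by (auto simp: k_def)
    ultimately show ?thesis
      by (cases "p = q") (simp_all del: of_int_diff)
  qed
  have "0 = app_op (\<Sum>p=1..n+1. poly_op (h p) (t * dt) * dt ^ (p - 1)) (fls_X_intpow k) $$ int x"
    by (simp only: assms zero_diff_op.rep_eq fls_zero_nth)
  also have "\<dots> = (\<Sum>p=1..n+1. if p = q then c q * poly (h q) (of_nat x) else 0)"
    unfolding app_op_sum fls_nth_sum by (intro sum.cong refl summand)
  also have "\<dots> = c q * poly (h q) (of_nat x)"
    using assms(2) by simp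
  finally have "c q * poly (h q) (of_nat x) = 0" by simp
  moreover have "c q \<noteq> 0"
    by (auto simp: c_def k_def simp del: of_int_diff)
  ultimately show "poly (h q) (of_nat x) = poly 0 (of_nat x)" by simp
qed

definition normal_form :: "nat \<Rightarrow> (nat \<Rightarrow> complex poly) \<Rightarrow> diff_op" where
  "normal_form n g = (t * dt) ^ n * t + (\<Sum>p=1..n+1. poly_op (g p) (t * dt) * dt ^ (p - 1))"

lemma normal_form_inject:
  "normal_form n f = normal_form n g \<longleftrightarrow> (\<forall>p\<in>{1..n+1}. f p = g p)"
proof
  assume eq: "normal_form n f = normal_form n g"
  have "(\<Sum>p=1..n+1. poly_op (f p - g p) (t * dt) * dt ^ (p - 1)) = normal_form n f - normal_form n g"
    by (simp add: normal_form_def poly_op_diff left_diff_distrib sum_subtractf)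
  also have "\<dots> = 0" using eq by simp
  finally have "f p - g p = 0" if "p \<in> {1..n+1}" for p
    using that by (rule poly_op_theta_dt_independent)
  thus "\<forall>p\<in>{1..n+1}. f p = g p" by simp
qed (simp add: normal_form_def)

text \<open>
  The substitution \<open>g\<^sub>p(x) \<mapsto> (-1)\<^sup>n\<^sup>-\<^sup>p\<^sup>+\<^sup>1 g\<^sub>p(-x - p)\<close>, whose fixed points are the symmetric families.
\<close>
definition reflect :: "nat \<Rightarrow> (nat \<Rightarrow> complex poly) \<Rightarrow> nat \<Rightarrow> complex poly" where
  "reflect n g p = smult ((-1) ^ (n + 1 - p)) (g p \<circ>\<^sub>p [:- of_nat p, - 1:])"

lemma symmetric_family_iff_reflect:
  "symmetric_family n g \<longleftrightarrow> (\<forall>p\<in>{1..n+1}. degree (g p) \<le> n + 1 - p \<and> g p = reflect n g p)"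
proof -
  have "(\<forall>x. poly (g p) x = (-1) ^ (n + 1 - p) * poly (g p) (- x - of_nat p)) \<longleftrightarrow> g p = reflect n g p" for p
    unfolding poly_eq_poly_eq_iff[symmetric]
    by (simp add: reflect_def fun_eq_iff poly_pcompose minus_diff_commute)
  thus ?thesis unfolding symmetric_family_def by simp
qed

lemma poly_op_reflect:
  "poly_op (reflect n g p) X = (-1) ^ (n + 1 - p) * poly_op (g p) (- X - of_nat p)"
proof -
  have "cst ((-1) ^ k) = (-1) ^ k" for k
    by (induction k) (simp_all add: cst_1 cst_minus)
  thus ?thesis
    by (simp add: reflect_def poly_op_smult poly_op_pcompose poly_op_linear cst_minus cst_of_nat cst_1
        minus_diff_commute)
qed

lemma minus_one_power_commute: "(-1) ^ k * X = X * (-1 :: diff_op) ^ k"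
  by (simp add: minus_one_power_iff)

text \<open>
  Since \<open>\<theta>\<^sup>\<or> = -\<theta> - 1\<close>, the leading term becomes \<open>(-1)\<^sup>n t (\<theta> + 1)\<^sup>n = (-1)\<^sup>n \<theta>\<^sup>n t\<close>, and the summand \<open>p\<close>
  becomes \<open>(-1)\<^sup>p\<^sup>-\<^sup>1 \<partial>\<^sub>t\<^sup>p\<^sup>-\<^sup>1 g\<^sub>p(-\<theta> - 1)\<close>, where moving the power of \<open>\<partial>\<^sub>t\<close> to the right turns
  \<open>-\<theta> - 1\<close> into \<open>-\<theta> - p\<close>.
\<close>
lemma dual_normal_form: "dual (normal_form n g) = (-1) ^ n * normal_form n (reflect n g)"
proof -
  have "t * (t * dt + 1) = t * dt * t"
    by (simp add: mult.assoc dt_t)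
  hence comm: "t * (t * dt + 1) ^ n = (t * dt) ^ n * t"
  proof (induction n)
    case (Suc n)
    thus ?case by (metis mult.assoc power_Suc)
  qed simp
  have "dual ((t * dt) ^ n * t) = t * (- (t * dt + 1)) ^ n"
    by (simp add: dual_mult[of "(t * dt) ^ n"] dual_power dual_theta dual_props)
  also have "\<dots> = (-1) ^ n * (t * (t * dt + 1) ^ n)"
    by (subst power_minus) (metis minus_one_power_commute mult.assoc)
  finally have lead: "dual ((t * dt) ^ n * t) = (-1) ^ n * ((t * dt) ^ n * t)"
    by (simp add: comm)
  have low: "dual (poly_op (g p) (t * dt) * dt ^ (p - 1)) =
      (-1) ^ n * (poly_op (reflect n g p) (t * dt) * dt ^ (p - 1))" if p: "p \<in> {1..n+1}" for p
  proof -
    define D where "D = t * dt"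
    obtain q where q: "p = Suc q" "q \<le> n" using p by (cases p) auto
    have "dt ^ q * (- D - 1) = - (dt ^ q * D) - dt ^ q"
      by (simp add: algebra_simps)
    also have "\<dots> = (- D - of_nat p) * dt ^ q"
      unfolding D_def dt_power_theta q by (simp add: algebra_simps)
    finally have "dt ^ q * poly_op (g p) (- D - 1) = poly_op (g p) (- D - of_nat p) * dt ^ q"
      by (rule poly_op_intertwine)
    moreover have "dual (poly_op (g p) D * dt ^ q) = (- dt) ^ q * poly_op (g p) (- D - 1)"
      by (simp add: dual_mult dual_poly_op dual_power dual_props D_def dt_t)
    ultimately have "dual (poly_op (g p) D * dt ^ q) = (-1) ^ q * poly_op (g p) (- D - of_nat p) * dt ^ q"
      by (simp add: power_minus[of dt] mult.assoc)
    also have "(-1) ^ q = (-1) ^ n * (-1 :: diff_op) ^ (n + 1 - p)"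
      using q by (auto simp: minus_one_power_iff)
    finally show ?thesis
      by (simp add: D_def q poly_op_reflect mult.assoc)
  qed
  show ?thesis
    unfolding normal_form_def dual_add dual_sum lead distrib_left sum_distrib_left
    by (intro arg_cong2[of _ _ _ _ "(+)"] sum.cong refl low)
qed

section \<open>The determinant in normal form\<close>

text \<open>
  The recursion of \<^const>\<open>hess_right\<close> for the entries \<open>\<delta>\<^sub>i\<^sub>j \<theta> - C\<^sub>i\<^sub>j \<partial>\<^sub>t\<^sup>j\<^sup>-\<^sup>i\<^sup>+\<^sup>1\<close>, carried out on the
  coefficients of an operator \<open>\<Sum> h\<^sub>p(\<theta>) \<partial>\<^sub>t\<^sup>p\<close>.  Multiplying on the right by a power of \<open>\<partial>\<^sub>t\<close> just shifts
  \<open>p\<close>, and multiplying by \<open>\<theta>\<close> on the right multiplies \<open>h\<^sub>p\<close> by \<open>x + p\<close>, because \<open>\<partial>\<^sub>t\<^sup>p \<theta> = (\<theta> + p) \<partial>\<^sub>t\<^sup>p\<close>.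
\<close>

function hess_coeff :: "(nat \<Rightarrow> nat \<Rightarrow> complex) \<Rightarrow> nat \<Rightarrow> nat \<Rightarrow> complex poly" where
  "hess_coeff C 0 p = (if p = 0 then 1 else 0)"
| "hess_coeff C (Suc m) p = [:of_nat p, 1:] * hess_coeff C m p -
     (\<Sum>i\<le>m. if Suc m - i \<le> p then smult (C i m) (hess_coeff C i (p - (Suc m - i))) else 0)"
  by pat_completeness auto
termination by (relation "measure (\<lambda>(C, m, p). m)") auto

lemma hess_coeff_eq_0: "m < p \<Longrightarrow> hess_coeff C m p = 0"
proof (induction m arbitrary: p rule: less_induct)
  case (less m)
  show ?case
  proof (cases m)
    case (Suc l)
    have "hess_coeff C l p = 0" using less Suc by simp
    moreover have "hess_coeff C i (p - (Suc l - i)) = 0" if "i \<le> l" for i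
      using less.prems Suc that by (intro less.IH) auto
    ultimately show ?thesis using Suc by (auto intro!: sum.neutral)
  qed (use less.prems in simp)
qed

lemma degree_hess_coeff: "degree (hess_coeff C m p) \<le> m - p"
proof (induction m arbitrary: p rule: less_induct)
  case (less m)
  show ?case
  proof (cases "m < p \<or> m = 0")
    case True
    thus ?thesis by (auto simp: hess_coeff_eq_0)
  next
    case False
    then obtain l where l: "m = Suc l" "p \<le> Suc l" by (cases m) auto
    have "degree ([:of_nat p, 1:] * hess_coeff C l p) \<le> m - p"
    proof (cases "p = Suc l")
      case False
      have "degree ([:of_nat p, 1:] * hess_coeff C l p) \<le> 1 + (l - p)"
        using less.IH[of l p] l by (intro order_trans[OF degree_mult_le] add_mono) auto
      thus ?thesis using l False by simp
    qed (simp add: hess_coeff_eq_0)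
    moreover have "degree (if Suc l - i \<le> p then smult (C i l) (hess_coeff C i (p - (Suc l - i))) else 0) \<le> m - p"
      if "i \<le> l" for i
      using less.IH[of i "p - (Suc l - i)"] that l
      by (auto intro!: order_trans[OF degree_smult_le])
    ultimately show ?thesis
      unfolding l hess_coeff.simps
      by (intro degree_diff_le degree_sum_le) (auto simp: l)
  qed
qed

lemma hess_coeff_order_0: "hess_coeff C m 0 = monom 1 m"
  by (induction m) (auto simp: monom_Suc intro!: sum.neutral)

definition theta_block :: "(nat \<Rightarrow> nat \<Rightarrow> complex) \<Rightarrow> nat \<Rightarrow> nat \<Rightarrow> diff_op" where
  "theta_block C i j = (if i = j then t * dt else 0) - cst (C i j) * dt ^ (Suc j - i)"

lemma hess_right_theta_block:
  "hess_right (theta_block C) m = (\<Sum>p\<le>m. poly_op (hess_coeff C m p) (t * dt) * dt ^ p)"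
proof (induction m rule: less_induct)
  case (less m)
  show ?case
  proof (cases m)
    case 0
    thus ?thesis by (simp add: poly_op_1)
  next
    case (Suc l)
    define D where "D = t * dt"
    define R where "R i = hess_right (theta_block C) i" for i
    define P where "P i p = poly_op (hess_coeff C i p) D" for i p
    have R: "R i = (\<Sum>p\<le>i. P i p * dt ^ p)" if "i \<le> l" for i
      unfolding R_def P_def D_def using that Suc by (intro less.IH) simp
    have "dt ^ p * D = poly_op [:of_nat p, 1:] D * dt ^ p" for p
      unfolding D_def dt_power_theta by (simp add: poly_op_linear cst_of_nat cst_1 add.commute)
    hence "P l p * dt ^ p * D = poly_op ([:of_nat p, 1:] * hess_coeff C l p) D * dt ^ p" for p
      by (subst mult.commute, subst poly_op_mult) (simp add: P_def mult.assoc)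
    hence diag: "R l * D = (\<Sum>p\<le>m. poly_op ([:of_nat p, 1:] * hess_coeff C l p) D * dt ^ p)"
      by (simp add: R Suc sum_distrib_right hess_coeff_eq_0 poly_op_0)
    have off: "R i * (cst (C i l) * dt ^ (Suc l - i)) =
        (\<Sum>p\<le>m. poly_op (if Suc l - i \<le> p then smult (C i l) (hess_coeff C i (p - (Suc l - i))) else 0) D * dt ^ p)"
      if "i \<le> l" for i
    proof -
      define k where "k = Suc l - i"
      have "R i * (cst (C i l) * dt ^ k) = (\<Sum>p\<le>i. cst (C i l) * P i p * dt ^ (p + k))"
        by (simp add: R that sum_distrib_right power_add mult.assoc cst_commute)
      also have "\<dots> = (\<Sum>p\<in>{k..m}. cst (C i l) * P i (p - k) * dt ^ p)"
        using that Suc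
        by (intro sum.reindex_bij_witness[of _ "\<lambda>p. p - k" "\<lambda>p. p + k"]) (auto simp: k_def)
      also have "\<dots> = (\<Sum>p\<le>m. if k \<le> p then cst (C i l) * P i (p - k) * dt ^ p else 0)"
        by (intro sum.mono_neutral_cong_left) auto
      also have "\<dots> = (\<Sum>p\<le>m. poly_op (if k \<le> p then smult (C i l) (hess_coeff C i (p - k)) else 0) D * dt ^ p)"
        by (intro sum.cong) (auto simp: P_def poly_op_smult poly_op_0)
      finally show ?thesis unfolding k_def .
    qed
    have "R m = (\<Sum>i\<le>l. R i * (if i = l then D else 0)) - (\<Sum>i\<le>l. R i * (cst (C i l) * dt ^ (Suc l - i)))"
      unfolding R_def Suc D_def by (simp add: theta_block_def right_diff_distrib sum_subtractf)
    also have "(\<Sum>i\<le>l. R i * (if i = l then D else 0)) = R l * D"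
      by (simp add: if_distrib[of "\<lambda>x. _ * x"] cong: if_cong)
    also have "(\<Sum>i\<le>l. R i * (cst (C i l) * dt ^ (Suc l - i))) = (\<Sum>i\<le>l. \<Sum>p\<le>m.
        poly_op (if Suc l - i \<le> p then smult (C i l) (hess_coeff C i (p - (Suc l - i))) else 0) D * dt ^ p)"
      by (intro sum.cong refl off) simp
    also have "\<dots> = (\<Sum>p\<le>m. \<Sum>i\<le>l.
        poly_op (if Suc l - i \<le> p then smult (C i l) (hess_coeff C i (p - (Suc l - i))) else 0) D * dt ^ p)"
      by (rule sum.swap)
    also have "R l * D - \<dots> = (\<Sum>p\<le>m. poly_op (hess_coeff C m p) D * dt ^ p)"
      unfolding diag Suc hess_coeff.simps(2) poly_op_diff poly_op_sum left_diff_distrib sum_distrib_right sum_subtractf ..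
    finally show ?thesis by (simp only: R_def D_def)
  qed
qed

section \<open>The normal form determines the matrix\<close>

lemma pCons_0_sum: "pCons 0 (\<Sum>i\<in>I. f i) = (\<Sum>i\<in>I. pCons 0 (f i))"
proof (induction I rule: infinite_finite_induct)
  case (insert i I)
  have "pCons 0 (f i + sum f I) = pCons 0 (f i) + pCons 0 (sum f I)" by simp
  thus ?case using insert by (simp del: add_pCons)
qed auto

text \<open>
  At \<open>x = 0\<close> only the summand \<open>i = 0\<close> survives, which fixes \<open>a 0\<close>.  What is left is divisible by \<open>x\<close>, and
  the quotient is an instance with \<open>N\<close> lowered by one.
\<close>
lemma weighted_poly_basis_exists:
  fixes f :: "complex poly" and c :: complex
  assumes "c \<noteq> 0" "degree f \<le> N"
  shows "\<exists>a. f = (\<Sum>i\<le>N. smult (a i) (monom 1 i * [:c, 1:] ^ (N - i)))"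
  using assms(2)
proof (induction N arbitrary: f)
  case 0
  then obtain a where "f = [:a:]" by (meson degree_0_id le_0_eq degree_eq_zeroE)
  thus ?case by (intro exI[of _ "\<lambda>_. a"]) simp
next
  case (Suc N)
  define a0 where "a0 = coeff f 0 / c ^ Suc N"
  define h where "h = f - smult a0 ([:c, 1:] ^ Suc N)"
  have "coeff h 0 = 0"
    using assms(1) by (simp add: h_def a0_def coeff_mult_0 coeff_0_power)
  then obtain f' where f': "h = pCons 0 f'"
    by (metis coeff_pCons_0 pCons_cases)
  have "degree h \<le> Suc N"
    unfolding h_def using Suc.prems order_trans[OF degree_smult_le eq_refl[OF degree_linear_power]]
    by (intro degree_diff_le)
  hence "degree f' \<le> N"
    by (cases "f' = 0") (auto simp: f')
  from Suc.IH[OF this] obtain a where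
    a: "f' = (\<Sum>i\<le>N. smult (a i) (monom 1 i * [:c, 1:] ^ (N - i)))" by blast
  have "h = (\<Sum>i\<le>N. smult (a i) (monom 1 (Suc i) * [:c, 1:] ^ (N - i)))"
    unfolding f' a by (simp add: monom_Suc pCons_0_sum)
  moreover have "f = smult a0 ([:c, 1:] ^ Suc N) + h" by (simp add: h_def)
  ultimately show ?case
    by (intro exI[of _ "case_nat a0 a"]) (simp only: sum.atMost_Suc_shift, simp)
qed

lemma weighted_poly_basis_independent:
  fixes c :: complex
  assumes "c \<noteq> 0" "(\<Sum>i\<le>N. smult (a i) (monom 1 i * [:c, 1:] ^ (N - i))) = 0" "i \<le> N"
  shows "a i = 0"
  using assms(2,3)
proof (induction N arbitrary: a i)
  case 0
  thus ?case by simp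
next
  case (Suc N)
  let ?S = "\<Sum>i\<le>N. smult (a (Suc i)) (monom 1 i * [:c, 1:] ^ (N - i))"
  have S: "smult (a 0) ([:c, 1:] ^ Suc N) + pCons 0 ?S = 0"
    using Suc.prems(1)
    by (simp only: sum.atMost_Suc_shift, simp add: monom_Suc pCons_0_sum)
  have "coeff (smult (a 0) ([:c, 1:] ^ Suc N) + pCons 0 ?S) 0 = 0"
    by (simp only: S coeff_0)
  hence a0: "a 0 = 0" using assms(1) by (simp add: coeff_mult_0 coeff_0_power)
  hence "?S = 0" using S by simp
  from Suc.IH[OF this] a0 Suc.prems(2) show ?case by (cases i) auto
qed

text \<open>
  If two matrices agree on the diagonals \<open>j - i < q\<close>, the coefficients at \<open>\<partial>\<^sub>t\<^sup>q\<^sup>+\<^sup>1\<close> first notice the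
  diagonal \<open>j - i = q\<close>.  An entry there uses up the whole exponent \<open>q + 1\<close>, so the intervals before and
  after it contribute plain powers of \<open>\<theta>\<close>: the product \<open>\<theta>\<^sup>i \<partial>\<^sub>t\<^sup>q\<^sup>+\<^sup>1 \<theta>\<^sup>m\<^sup>-\<^sup>1\<^sup>-\<^sup>q\<^sup>-\<^sup>i\<close> has the coefficient
  \<open>x\<^sup>i (x + q + 1)\<^sup>m\<^sup>-\<^sup>1\<^sup>-\<^sup>q\<^sup>-\<^sup>i\<close>.
\<close>
lemma hess_coeff_first_difference:
  assumes "\<And>i j. i \<le> j \<Longrightarrow> j < m \<Longrightarrow> j < i + q \<Longrightarrow> C i j = C' i j"
  shows "(\<forall>p\<le>q. hess_coeff C m p = hess_coeff C' m p) \<and>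
    hess_coeff C' m (Suc q) - hess_coeff C m (Suc q) =
    (\<Sum>i<m - q. smult (C i (i + q) - C' i (i + q)) (monom 1 i * [:of_nat (Suc q), 1:] ^ (m - 1 - q - i)))"
  using assms
proof (induction m rule: less_induct)
  case (less m)
  show ?case
  proof (cases m)
    case (Suc l)
    have IH: "\<forall>p\<le>q. hess_coeff C i p = hess_coeff C' i p" if "i \<le> l" for i
      using less.IH[of i] less.prems that Suc by auto
    have low: "hess_coeff C m p = hess_coeff C' m p" if "p \<le> q" for p
    proof -
      have "C i l = C' i l" if "i \<le> l" "Suc l - i \<le> p" for i
        using that \<open>p \<le> q\<close> Suc by (intro less.prems) auto
      thus ?thesis using that IH unfolding Suc hess_coeff.simps
        by (intro arg_cong2[of _ _ _ _ "(-)"] sum.cong) auto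
    qed
    define x where "x = [:of_nat (Suc q), 1 :: complex:]"
    define a where "a i = C i (i + q) - C' i (i + q)" for i
    let ?T = "\<lambda>C i. if Suc l - i \<le> Suc q then smult (C i l) (hess_coeff C i (Suc q - (Suc l - i))) else 0"
    \<comment> \<open>On earlier diagonals both factors agree; on the diagonal \<open>q\<close> the remaining exponent is \<open>0\<close>.\<close>
    have T: "?T C i - ?T C' i = (if i + q = l then smult (a i) (monom 1 i) else 0)" if i: "i \<le> l" for i
    proof (cases "l < i + q")
      case True
      hence "C i l = C' i l" using i Suc by (intro less.prems) auto
      moreover have "hess_coeff C i (Suc q - (Suc l - i)) = hess_coeff C' i (Suc q - (Suc l - i))"
        using IH[OF i] i by simp
      ultimately show ?thesis using True by simp
    next
      case False
      thus ?thesis using i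
        by (auto simp: a_def hess_coeff_order_0 smult_diff_left)
    qed
    have "hess_coeff C' m (Suc q) - hess_coeff C m (Suc q) =
        x * (hess_coeff C' l (Suc q) - hess_coeff C l (Suc q)) + ((\<Sum>i\<le>l. ?T C i) - (\<Sum>i\<le>l. ?T C' i))"
      unfolding Suc hess_coeff.simps x_def by (simp only: right_diff_distrib) simp
    also have "(\<Sum>i\<le>l. ?T C i) - (\<Sum>i\<le>l. ?T C' i) = (\<Sum>i\<le>l. if i + q = l then smult (a i) (monom 1 i) else 0)"
      unfolding sum_subtractf[symmetric] by (intro sum.cong refl T) simp
    also have "\<dots> = (\<Sum>i\<le>l. if i = l - q then if q \<le> l then smult (a i) (monom 1 i) else 0 else 0)"
      by (intro sum.cong) auto
    also have "\<dots> = (if q \<le> l then smult (a (l - q)) (monom 1 (l - q)) else 0)"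
      by simp
    also have "hess_coeff C' l (Suc q) - hess_coeff C l (Suc q) =
        (\<Sum>i<l - q. smult (a i) (monom 1 i * x ^ (l - 1 - q - i)))"
      using less.IH[of l] less.prems Suc by (simp add: a_def x_def)
    also have "x * \<dots> = (\<Sum>i<l - q. smult (a i) (monom 1 i * x ^ (l - q - i)))"
      unfolding sum_distrib_left
    proof (intro sum.cong refl)
      fix i assume "i \<in> {..<l - q}"
      hence "l - q - i = Suc (l - 1 - q - i)" by auto
      thus "x * smult (a i) (monom 1 i * x ^ (l - 1 - q - i)) = smult (a i) (monom 1 i * x ^ (l - q - i))"
        by (simp only: power_Suc mult_smult_right mult.left_commute)
    qed
    also have "\<dots> + (if q \<le> l then smult (a (l - q)) (monom 1 (l - q)) else 0) =
        (\<Sum>i<m - q. smult (a i) (monom 1 i * x ^ (m - 1 - q - i)))"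
      by (simp add: Suc Suc_diff_le)
    finally show ?thesis using low by (simp add: a_def x_def)
  qed simp
qed

lemma hess_coeff_cong:
  assumes "\<And>i j. i \<le> j \<Longrightarrow> j < m \<Longrightarrow> C i j = C' i j"
  shows "hess_coeff C m p = hess_coeff C' m p"
  using hess_coeff_first_difference[of m p C C'] assms by auto

text \<open>
  The diagonals are adjusted one after another; each adjustment leaves the coefficients that are
  already correct untouched.
\<close>
lemma hess_coeff_surj:
  assumes "\<And>p. p \<in> {1..n+1} \<Longrightarrow> degree (g p) \<le> n + 1 - p"
  shows "\<exists>C. \<forall>p\<in>{1..n+1}. hess_coeff C (Suc n) p = g p"
proof -
  have "\<exists>C. \<forall>p\<in>{1..q}. hess_coeff C (Suc n) p = g p" if "q \<le> n + 1" for q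
    using that
  proof (induction q)
    case (Suc q)
    then obtain C where C: "\<forall>p\<in>{1..q}. hess_coeff C (Suc n) p = g p" by auto
    have "degree (hess_coeff C (Suc n) (Suc q) - g (Suc q)) \<le> n - q"
      using degree_hess_coeff[of C "Suc n" "Suc q"] assms[of "Suc q"] Suc.prems
      by (intro degree_diff_le) auto
    from weighted_poly_basis_exists[OF _ this, of "of_nat (Suc q)"] obtain a where
      a: "hess_coeff C (Suc n) (Suc q) - g (Suc q) =
        (\<Sum>i\<le>n - q. smult (a i) (monom 1 i * [:of_nat (Suc q), 1:] ^ (n - q - i)))"
      using of_nat_neq_0 by blast
    \<comment> \<open>A change of the diagonal by \<open>a\<close> lowers the next coefficient by the combination with coefficients \<open>a\<close>.\<close>
      define C' where "C' i j = (if j = i + q then C i j + a i else C i j)" for i j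
    have diff: "\<forall>p\<le>q. hess_coeff C' (Suc n) p = hess_coeff C (Suc n) p"
      "hess_coeff C (Suc n) (Suc q) - hess_coeff C' (Suc n) (Suc q) =
       (\<Sum>i<Suc n - q. smult (C' i (i + q) - C i (i + q)) (monom 1 i * [:of_nat (Suc q), 1:] ^ (Suc n - 1 - q - i)))"
      using hess_coeff_first_difference[of "Suc n" q C' C] by (auto simp: C'_def)
    have "{..<Suc n - q} = {..n - q}" using Suc.prems by auto
    hence "hess_coeff C (Suc n) (Suc q) - hess_coeff C' (Suc n) (Suc q) = hess_coeff C (Suc n) (Suc q) - g (Suc q)"
      unfolding a diff(2) by (intro sum.cong) (auto simp: C'_def)
    hence "hess_coeff C' (Suc n) (Suc q) = g (Suc q)" by (simp del: hess_coeff.simps)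
    hence "\<forall>p\<in>{1..Suc q}. hess_coeff C' (Suc n) p = g p"
      using diff(1) C by (auto simp: le_Suc_eq simp del: hess_coeff.simps)
    thus ?case by blast
  qed simp
  thus ?thesis by blast
qed

lemma hess_coeff_inj:
  assumes eq: "\<And>p. p \<in> {1..n+1} \<Longrightarrow> hess_coeff C (Suc n) p = hess_coeff C' (Suc n) p"
    and "i \<le> j" "j \<le> n"
  shows "C i j = C' i j"
proof -
  have "\<forall>i. i + q \<le> n \<longrightarrow> C i (i + q) = C' i (i + q)" for q
  proof (induction q rule: less_induct)
    case (less q)
    show ?case
    proof (intro allI impI)
      fix i assume i: "i + q \<le> n"
      have "C i j = C' i j" if "i \<le> j" "j < Suc n" "j < i + q" for i j
        using less.IH[rule_format, of "j - i" i] that by simp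
      from hess_coeff_first_difference[of "Suc n" q C C', OF this] eq[of "Suc q"] i
      have "(\<Sum>i<Suc n - q. smult (C i (i + q) - C' i (i + q)) (monom 1 i * [:of_nat (Suc q), 1:] ^ (Suc n - 1 - q - i))) = 0"
        by (simp del: hess_coeff.simps)
      moreover have "{..<Suc n - q} = {..n - q}" using i by auto
      ultimately have "(\<Sum>i\<le>n - q. smult (C i (i + q) - C' i (i + q)) (monom 1 i * [:of_nat (Suc q), 1:] ^ (n - q - i))) = 0"
        by simp
      from weighted_poly_basis_independent[OF _ this, of i] i show "C i (i + q) = C' i (i + q)"
        using of_nat_neq_0[where 'a = complex, of q] by auto
    qed
  qed
  from this[rule_format, of i "j - i"] assms(2,3) show ?thesis by simp
qed

section \<open>The operators at infinity\<close>

lemma normal_form_mult_dt: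
  assumes "g 0 = monom 1 (Suc n)"
  shows "normal_form n g * dt = (\<Sum>p\<le>Suc n. poly_op (g p) (t * dt) * dt ^ p)"
proof -
  have "poly_op (monom 1 k) X = X ^ k" for k X
    by (induction k) (simp_all add: monom_Suc poly_op_pCons cst_0 poly_op_1)
  hence "(t * dt) ^ n * t * dt = poly_op (g 0) (t * dt) * dt ^ 0"
    unfolding assms by (simp only: power_Suc2 mult.assoc power_0 mult_1_right)
  moreover have "(\<Sum>p=1..n+1. poly_op (g p) (t * dt) * dt ^ (p - 1)) * dt =
      (\<Sum>p=1..n+1. poly_op (g p) (t * dt) * dt ^ p)"
    unfolding sum_distrib_right
  proof (intro sum.cong refl)
    fix p assume "p \<in> {1..n+1}"
    then obtain q where "p = Suc q" by (cases p) auto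
    thus "poly_op (g p) (t * dt) * dt ^ (p - 1) * dt = poly_op (g p) (t * dt) * dt ^ p"
      by (simp add: mult.assoc power_commutes)
  qed
  ultimately have "normal_form n g * dt = poly_op (g 0) (t * dt) * dt ^ 0 +
      (\<Sum>p=1..Suc n. poly_op (g p) (t * dt) * dt ^ p)"
    by (simp only: normal_form_def distrib_right Suc_eq_plus1)
  also have "\<dots> = (\<Sum>p\<le>Suc n. poly_op (g p) (t * dt) * dt ^ p)"
    unfolding atMost_atLeast0 by (subst (2) sum.atLeast_Suc_atMost) simp_all
  finally show ?thesis .
qed

lemma weyl_normal_form: "normal_form n g \<in> weyl"
proof -
  have zero: "0 \<in> weyl" and one: "1 \<in> weyl"
    using weyl.scalar[of 0] weyl.scalar[of 1] by (simp_all add: cst_0 cst_1)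
  have power: "X ^ k \<in> weyl" if "X \<in> weyl" for X k
    by (induction k) (use one that weyl.mult in auto)
  have sum: "(\<Sum>i\<in>I. f i) \<in> weyl" if "\<And>i. f i \<in> weyl" for I :: "nat set" and f
    by (induction I rule: infinite_finite_induct) (use zero that weyl.add in auto)
  show ?thesis
    unfolding normal_form_def poly_op_def
    by (intro weyl.add weyl.mult sum power weyl.t weyl.dt weyl.scalar)
qed

text \<open>
  The determinant starts its intervals at \<open>0\<close> and multiplies later ones from the left.  Read from
  the other end, with \<open>i\<close> replaced by \<open>n - i\<close>, this is a sum with later intervals to the right, and the
  entries are those of \<open>A\<^sup>\<tau>\<close>.
\<close>
lemma det_op_eq_hess_right:
  assumes "admissible n A"
  shows "det_op n A = hess_right (theta_block (mat_tau n A)) (Suc n)"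
proof -
  define M where "M i j = (if i = j then t * dt else 0) - mat_tilde A i j" for i j
  have "det_op n A = det_right n M"
    unfolding det_op_def M_def ..
  also have "\<dots> = hess_right (\<lambda>i j. M (n - j) (n - i)) (Suc n)"
  proof (rule det_right_hessenberg)
    fix j assume "j < n"
    hence "Suc j \<le> n" "j \<le> n" by auto
    hence "A (Suc j) j = 1" using assms unfolding admissible_def Suc_eq_plus1 by blast
    thus "M (Suc j) j = - 1" by (simp add: M_def mat_tilde_def cst_1)
  qed (simp add: M_def mat_tilde_def)
  also have "\<dots> = hess_right (theta_block (mat_tau n A)) (Suc n)"
  proof (rule hess_right_cong)
    fix i j assume "i \<le> j" "j < Suc n"
    hence "n - j = n - i \<longleftrightarrow> i = j" "\<not> n - j > n - i + 1" "n - i + 1 - (n - j) = Suc j - i" by auto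
    thus "M (n - j) (n - i) = theta_block (mat_tau n A) i j"
      by (simp add: M_def theta_block_def mat_tilde_def mat_tau_def)
  qed
  finally show ?thesis .
qed

lemma mult_dt_cancel: "X * dt = Y * dt \<Longrightarrow> X = Y"
  using mult_dt_eq_0D[of "X - Y"] by (simp add: left_diff_distrib)

lemma L_inf_eq_normal_form:
  assumes "admissible n A"
  shows "L_inf n A = normal_form n (hess_coeff (mat_tau n A) (Suc n))"
    and "L_inf n A * dt = det_op n A"
proof -
  have eq: "normal_form n (hess_coeff (mat_tau n A) (Suc n)) * dt = det_op n A"
    using assms
    by (simp only: normal_form_mult_dt[of "hess_coeff (mat_tau n A) (Suc n)", OF hess_coeff_order_0] det_op_eq_hess_right hess_right_theta_block)
  show L: "L_inf n A = normal_form n (hess_coeff (mat_tau n A) (Suc n))"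
    unfolding L_inf_def
  proof (rule the_equality)
    fix L assume "L \<in> weyl \<and> L * dt = det_op n A"
    thus "L = normal_form n (hess_coeff (mat_tau n A) (Suc n))"
      using eq mult_dt_cancel by metis
  qed (use eq weyl_normal_form in blast)
  show "L_inf n A * dt = det_op n A" using L eq by simp
qed

lemma admissible_mat_tau: "admissible n A \<Longrightarrow> admissible n (mat_tau n A)"
  unfolding admissible_def mat_tau_def
proof (intro allI impI)
  fix i j assume A: "\<forall>i\<le>n. \<forall>j\<le>n. (j + 1 < i \<longrightarrow> A i j = 0) \<and> (i = j + 1 \<longrightarrow> A i j = 1)"
    and "i \<le> n" "j \<le> n"
  hence "n - j > n - i + 1 \<longleftrightarrow> i > j + 1" "n - j = n - i + 1 \<longleftrightarrow> i = j + 1" by auto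
  moreover have "(n - i + 1 < n - j \<longrightarrow> A (n - j) (n - i) = 0) \<and> (n - j = n - i + 1 \<longrightarrow> A (n - j) (n - i) = 1)"
    using A by (meson diff_le_self)
  ultimately show "(j + 1 < i \<longrightarrow> A (n - j) (n - i) = 0) \<and> (i = j + 1 \<longrightarrow> A (n - j) (n - i) = 1)"
    by blast
qed

lemma hess_right_mat_tau_mat_tau:
  "hess_right (theta_block (mat_tau n (mat_tau n A))) (Suc n) = hess_right (theta_block A) (Suc n)"
  by (rule hess_right_cong) (simp add: theta_block_def mat_tau_def)

lemma dual_hess_left: "dual (hess_left b m) = hess_right (\<lambda>i j. dual (b i j)) m"
proof (induction m rule: less_induct)
  case (less m)
  thus ?case by (cases m) (auto simp: dual_1 dual_sum dual_mult intro!: sum.cong)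
qed

text \<open>
  The diagonal entries obey the same rule as the others because
  \<open>\<theta>\<^sup>\<or> \<partial>\<^sub>t = -(\<theta> + 1) \<partial>\<^sub>t = -\<partial>\<^sub>t \<theta>\<close>.
\<close>
lemma dual_theta_block_mult_dt:
  assumes "i \<le> j"
  shows "dual (theta_block C i j) * dt = (-1) ^ (Suc j - i) * (dt * theta_block C i j)"
proof -
  define k where "k = Suc j - i"
  have "dual (cst (C i j) * dt ^ k) * dt = (-1) ^ k * (dt * (cst (C i j) * dt ^ k))"
  proof -
    have "dt ^ k * (cst (C i j) * dt) = dt * (cst (C i j) * dt ^ k)"
      by (metis cst_commute mult.assoc power_commutes)
    thus ?thesis
      by (simp add: dual_mult dual_cst dual_power dual_props power_minus[of dt] mult.assoc)
  qed
  moreover have "dual (if i = j then t * dt else 0) * dt = (-1) ^ k * (dt * (if i = j then t * dt else 0))"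
  proof -
    have "dt * (t * dt) = (t * dt + 1) * dt"
      by (simp only: mult.assoc[symmetric] dt_t)
    thus ?thesis
      by (simp add: k_def dual_0 dual_theta left_diff_distrib distrib_right)
  qed
  moreover have "dual (theta_block C i j) = dual (if i = j then t * dt else 0) - dual (cst (C i j) * dt ^ k)"
    unfolding theta_block_def k_def diff_conv_add_uminus dual_add dual_minus ..
  ultimately show ?thesis
    by (simp only: theta_block_def k_def left_diff_distrib right_diff_distrib)
qed

text \<open>
  The factor \<open>\<partial>\<^sub>t\<close> travels through each product from right to left.  The lengths of the intervals add
  up to \<open>m\<close>, so the sign is the same for all products.
\<close>
lemma hess_right_dual_theta_block:
  "hess_right (\<lambda>i j. dual (theta_block C i j)) m * dt = (-1) ^ m * (dt * hess_right (theta_block C) m)"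
proof (induction m rule: less_induct)
  case (less m)
  show ?case
  proof (cases m)
    case (Suc l)
    let ?R = "hess_right (\<lambda>i j. dual (theta_block C i j))"
    have "?R i * dual (theta_block C i l) * dt = (-1) ^ m * (dt * (hess_right (theta_block C) i * theta_block C i l))"
      if i: "i \<le> l" for i
    proof -
      have "?R i * dual (theta_block C i l) * dt = ?R i * ((-1) ^ (Suc l - i) * (dt * theta_block C i l))"
        by (simp only: mult.assoc dual_theta_block_mult_dt[OF i])
      also have "\<dots> = (-1) ^ (Suc l - i) * (?R i * dt * theta_block C i l)"
        by (metis minus_one_power_commute mult.assoc)
      also have "?R i * dt = (-1) ^ i * (dt * hess_right (theta_block C) i)"
        using i Suc by (intro less.IH) simp
      also have "(-1) ^ (Suc l - i) * ((-1) ^ i * (dt * hess_right (theta_block C) i) * theta_block C i l) =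
          (-1) ^ (Suc l - i + i) * (dt * (hess_right (theta_block C) i * theta_block C i l))"
        by (simp only: power_add mult.assoc)
      finally show ?thesis using i Suc by simp
    qed
    thus ?thesis
      unfolding Suc hess_right.simps sum_distrib_left sum_distrib_right by (intro sum.cong) auto
  qed simp
qed

text \<open>
  Dualising \<open>L\<^sub>A \<partial>\<^sub>t\<close> puts a factor \<open>-\<partial>\<^sub>t\<close> on the left; a further factor \<open>\<partial>\<^sub>t\<close> on the right provides the
  one that the dualised determinant needs in order to turn into the determinant of \<open>A\<^sup>\<tau>\<close>.  Both
  can then be cancelled.
\<close>
lemma dual_L_inf:
  assumes "admissible n A"
  shows "dual (L_inf n A) = (-1) ^ n * L_inf n (mat_tau n A)"
proof -
  let ?R = "hess_right (theta_block A) (Suc n)"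
  have "det_op n A = hess_left (theta_block A) (Suc n)"
    unfolding det_op_eq_hess_right[OF assms] hess_left_eq_hess_right_flip
    by (rule hess_right_cong) (auto simp: theta_block_def mat_tau_def)
  hence "dual (det_op n A) * dt = (-1) ^ Suc n * (dt * ?R)"
    by (simp only: dual_hess_left hess_right_dual_theta_block)
  moreover have "?R = L_inf n (mat_tau n A) * dt"
    using assms by (simp only: L_inf_eq_normal_form(2) det_op_eq_hess_right admissible_mat_tau
      hess_right_mat_tau_mat_tau)
  moreover have "dual (det_op n A) * dt = - (dt * (dual (L_inf n A) * dt))"
    unfolding L_inf_eq_normal_form(2)[OF assms, symmetric] by (simp add: dual_mult dual_props mult.assoc)
  ultimately have "dt * (dual (L_inf n A) * dt) = (-1) ^ n * (dt * (L_inf n (mat_tau n A) * dt))"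
    by simp
  hence "dt * (dual (L_inf n A) - (-1) ^ n * L_inf n (mat_tau n A)) * dt = 0"
    by (simp add: left_diff_distrib right_diff_distrib mult.assoc minus_one_power_iff)
  hence "dual (L_inf n A) - (-1) ^ n * L_inf n (mat_tau n A) = 0"
    using mult_dt_eq_0D dt_mult_eq_0D by blast
  thus ?thesis by simp
qed

lemma L_inf_tau_symmetric:
  assumes "admissible n A" "tau_symmetric n A"
  shows "L_inf n (mat_tau n A) = L_inf n A"
proof -
  have "hess_right (theta_block (mat_tau n A)) (Suc n) = hess_right (theta_block A) (Suc n)"
    using assms(2) by (intro hess_right_cong) (auto simp: tau_symmetric_def theta_block_def)
  hence "det_op n (mat_tau n A) = det_op n A"
    using assms(1) by (simp only: det_op_eq_hess_right admissible_mat_tau hess_right_mat_tau_mat_tau)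
  thus ?thesis by (simp add: L_inf_def)
qed

lemma dual_type_DN_inf_1:
  "L \<in> type_DN_inf_1 n \<Longrightarrow> dual L = (-1) ^ n * L"
  by (auto simp: type_DN_inf_1_def dual_L_inf L_inf_tau_symmetric)

lemma dual_normal_form_eq_iff:
  "dual (normal_form n g) = (-1) ^ n * normal_form n g \<longleftrightarrow> (\<forall>p\<in>{1..n+1}. g p = reflect n g p)"
proof -
  have "(-1) ^ n * X = (-1) ^ n * Y \<longleftrightarrow> X = Y" for X Y :: diff_op
    by (simp add: minus_one_power_iff)
  thus ?thesis
    unfolding dual_normal_form normal_form_inject by (metis normal_form_inject)
qed

text \<open>
  Some matrix \<open>A\<close> has the prescribed coefficients.  Symmetry of the family says that the dual of its
  operator is, up to sign, the operator itself, but that dual belongs to \<open>A\<^sup>\<tau>\<close>.  As the operator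
  determines the matrix, \<open>A = A\<^sup>\<tau>\<close>.
\<close>
lemma tau_symmetric_L_inf_surj:
  assumes "symmetric_family n g"
  shows "\<exists>A. admissible n A \<and> tau_symmetric n A \<and> L_inf n A = normal_form n g"
proof -
  obtain C where C: "\<forall>p\<in>{1..n+1}. hess_coeff C (Suc n) p = g p"
    using hess_coeff_surj[of n g] assms unfolding symmetric_family_def by blast
  \<comment> \<open>The coefficients are those of \<open>A\<^sup>\<tau>\<close>, so \<open>C\<close> has to be reflected.\<close>
  define A where "A i j = (if i > j + 1 then 0 else if i = j + 1 then 1 else C (n - j) (n - i))" for i j
  have adm: "admissible n A" by (simp add: admissible_def A_def)
  have "hess_coeff (mat_tau n A) (Suc n) p = hess_coeff C (Suc n) p" for p
    by (rule hess_coeff_cong) (auto simp: A_def mat_tau_def)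
  hence L: "L_inf n A = normal_form n g"
    unfolding L_inf_eq_normal_form(1)[OF adm] normal_form_inject using C by metis
  have "(-1) ^ n * L_inf n (mat_tau n A) = (-1) ^ n * L_inf n A"
    unfolding dual_L_inf[OF adm, symmetric] L dual_normal_form_eq_iff
    using assms symmetric_family_iff_reflect by blast
  hence "L_inf n (mat_tau n A) = L_inf n A"
    by (simp add: minus_one_power_iff split: if_splits)
  hence coeffs: "hess_coeff (mat_tau n (mat_tau n A)) (Suc n) p = hess_coeff (mat_tau n A) (Suc n) p"
    if "p \<in> {1..n+1}" for p
    using that
    unfolding L_inf_eq_normal_form(1)[OF adm] L_inf_eq_normal_form(1)[OF admissible_mat_tau[OF adm]] normal_form_inject
    by blast
  have "A i j = mat_tau n A i j" if ij: "i \<le> n" "j \<le> n" for i j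
  proof (cases "i \<le> j")
    case True
    have "mat_tau n (mat_tau n A) i j = mat_tau n A i j"
      by (rule hess_coeff_inj[OF coeffs True \<open>j \<le> n\<close>])
    thus ?thesis using ij by (simp add: mat_tau_def)
  next
    case False
    thus ?thesis using ij by (auto simp: A_def mat_tau_def)
  qed
  thus ?thesis using adm L unfolding tau_symmetric_def by blast
qed

lemma symmetric_family_hess_coeff:
  assumes "admissible n A" "tau_symmetric n A"
  shows "symmetric_family n (hess_coeff (mat_tau n A) (Suc n))"
proof -
  have "dual (L_inf n A) = (-1) ^ n * L_inf n A"
    by (simp add: assms dual_L_inf L_inf_tau_symmetric)
  hence "\<forall>p\<in>{1..n+1}. hess_coeff (mat_tau n A) (Suc n) p = reflect n (hess_coeff (mat_tau n A) (Suc n)) p"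
    unfolding L_inf_eq_normal_form(1)[OF assms(1)] dual_normal_form_eq_iff .
  thus ?thesis
    unfolding symmetric_family_iff_reflect using degree_hess_coeff by (metis Suc_eq_plus1)
qed

lemma type_DN_inf_1_eq: "type_DN_inf_1 n = {normal_form n g | g. symmetric_family n g}"
proof (intro equalityI subsetI)
  fix L assume "L \<in> type_DN_inf_1 n"
  then obtain A where "admissible n A" "tau_symmetric n A" "L = L_inf n A"
    unfolding type_DN_inf_1_def by blast
  thus "L \<in> {normal_form n g | g. symmetric_family n g}"
    using L_inf_eq_normal_form(1) symmetric_family_hess_coeff by blast
next
  fix L assume "L \<in> {normal_form n g | g. symmetric_family n g}"
  then obtain g where "symmetric_family n g" "L = normal_form n g" by blast
  thus "L \<in> type_DN_inf_1 n"
    using tau_symmetric_L_inf_surj[of n g] unfolding type_DN_inf_1_def mem_Collect_eq by metis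
qed

section \<open>The operators at zero\<close>

lemma theta_eq: "t * dt = - (w * dw)"
proof -
  have "w * dw = - (t_inv * t * (t * dt))"
    by (simp only: w_def dw_def power2_eq_square mult.assoc mult_minus_right)
  thus ?thesis by simp
qed

lemma L_zero_eq:
  assumes "admissible n A"
  shows "L_zero n A = (-1) ^ n * (L_inf n A * w)"
proof -
  define g where "g = (\<lambda>p. if p \<in> {1..n+1} then hess_coeff (mat_tau n A) (Suc n) p else 0)"
  have g: "g_coeffs n A = g"
    unfolding g_coeffs_def normal_form_def[symmetric] L_inf_eq_normal_form(1)[OF assms]
  proof (rule the_equality)
    show "(\<forall>p. p \<notin> {1..n + 1} \<longrightarrow> g p = 0) \<and> (\<forall>p\<in>{1..n + 1}. degree (g p) \<le> n + 1 - p) \<and>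
        normal_form n (hess_coeff (mat_tau n A) (Suc n)) = normal_form n g"
      using degree_hess_coeff[of "mat_tau n A" "Suc n"] unfolding normal_form_inject by (simp add: g_def)
    fix h assume "(\<forall>p. p \<notin> {1..n + 1} \<longrightarrow> h p = 0) \<and> (\<forall>p\<in>{1..n + 1}. degree (h p) \<le> n + 1 - p) \<and>
        normal_form n (hess_coeff (mat_tau n A) (Suc n)) = normal_form n h"
    thus "h = g" unfolding normal_form_inject by (auto simp: g_def fun_eq_iff)
  qed
  have L: "L_inf n A = normal_form n g"
    unfolding L_inf_eq_normal_form(1)[OF assms] normal_form_inject by (simp add: g_def)
  have wdw: "w * dw = - (t * dt)" by (simp add: theta_eq)
  have "t * w = 1" by (simp add: w_def)
  hence "(w * dw) ^ n = (-1) ^ n * ((t * dt) ^ n * t * w)"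
    by (simp add: wdw power_minus[of "t * dt"] mult.assoc)
  thus ?thesis
    unfolding L_zero_def L g normal_form_def wdw dt_eq_dw[symmetric]
    by (simp add: dt_eq_dw[symmetric] distrib_left distrib_right sum_distrib_left sum_distrib_right mult.assoc)
qed

lemma dual_w: "dual w = w"
proof -
  have "dual (t * w) = dual w * t" by (simp add: dual_mult dual_props)
  hence "dual w * t = 1" by (simp add: w_def dual_1)
  hence "dual w * t * w = w" by simp
  thus ?thesis by (simp add: mult.assoc w_def)
qed

lemma dual_type_DN_0_0:
  assumes "L \<in> type_DN_0_0 n"
  shows "dual L = (-1) ^ n * (w * L * w_inv)"
proof -
  obtain A where A: "admissible n A" "tau_symmetric n A" "L = (-1) ^ n * (L_inf n A * w)"
    using assms unfolding type_DN_0_0_def by (auto simp: L_zero_eq)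
  have dual_minus_power: "dual ((-1) ^ n * X) = (-1) ^ n * dual X" for X
    by (simp add: minus_one_power_iff dual_minus)
  have "dual L = (-1) ^ n * (w * ((-1) ^ n * L_inf n A))"
    unfolding A(3) dual_minus_power dual_mult[of "L_inf n A"] dual_w dual_L_inf[OF A(1)]
      L_inf_tau_symmetric[OF A(1,2)] ..
  also have "(-1) ^ n * L_inf n A = L * w_inv"
    by (simp add: A(3) mult.assoc)
  finally show ?thesis by (simp add: mult.assoc)
qed

lemma euler_w_power: "w * dw * w ^ k = w ^ k * (w * dw + of_nat k)"
proof (induction k)
  case (Suc k)
  have "w * dw * w ^ Suc k = w * (dw * w) * w ^ k"
    by (simp add: mult.assoc)
  also have "\<dots> = w * (w * dw * w ^ k) + w * w ^ k"
    by (simp add: dw_w distrib_left distrib_right mult.assoc)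
  also have "\<dots> = w ^ Suc k * (w * dw + of_nat (Suc k))"
    unfolding Suc by (simp only: power_Suc of_nat_Suc distrib_left mult.assoc mult_1_right add_ac)
  finally show ?case .
qed simp

lemma w2_dw_power_w:
  "(w^2 * dw) ^ k * w = w ^ Suc k * prod_list (map (\<lambda>l. w * dw + of_nat l) [1..<Suc k])"
proof (induction k)
  case (Suc k)
  define E where "E = w * dw"
  define Q where "Q k = prod_list (map (\<lambda>l. E + of_nat l) [1..<Suc k])" for k
  have Q_Suc: "Q (Suc k) = Q k * (E + of_nat (Suc k))" for k
    by (simp add: Q_def)
  have E_comm: "E * (E + of_nat j) = (E + of_nat j) * E" for j
    by (simp only: distrib_left distrib_right mult_of_nat_commute)
  have "E * Q k = Q k * E" for k
  proof (induction k)
    case (Suc k)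
    thus ?case unfolding Q_Suc by (metis E_comm mult.assoc)
  qed (simp add: Q_def)
  hence comm: "(E + of_nat j) * Q k = Q k * (E + of_nat j)" for j
    by (simp only: distrib_left distrib_right mult_of_nat_commute)
  have "(w^2 * dw) ^ Suc k * w = w * (E * w ^ Suc k) * Q k"
    unfolding power_Suc[of "w^2 * dw"] mult.assoc[of "w^2 * dw"] Suc
    by (simp add: E_def Q_def power2_eq_square mult.assoc del: upt_Suc)
  also have "\<dots> = w ^ Suc (Suc k) * ((E + of_nat (Suc k)) * Q k)"
    unfolding E_def euler_w_power by (simp only: power_Suc mult.assoc)
  also have "(E + of_nat (Suc k)) * Q k = Q (Suc k)"
    unfolding comm Q_Suc ..
  finally show ?case by (simp only: Q_def E_def)
qed simp

text \<open>
  Here \<open>\<theta> = -E\<close> with \<open>E = w \<partial>\<^sub>w\<close>, and \<open>\<partial>\<^sub>t\<^sup>p\<^sup>-\<^sup>1 w\<close> is \<open>(-1)\<^sup>p\<^sup>-\<^sup>1 w\<^sup>p\<close> times \<open>\<Prod> (E + l)\<close>.  Moving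
  \<open>w\<^sup>p\<close> to the left of \<open>g\<^sub>p(-E)\<close> yields \<open>g\<^sub>p(-E - p)\<close>, and the three signs cancel when the symmetry
  turns this back into \<open>g\<^sub>p(E)\<close>.
\<close>
lemma symmetric_normal_form_at_w:
  assumes "symmetric_family n g"
  shows "(-1) ^ n * (normal_form n g * w) = (w * dw) ^ n +
    (\<Sum>p=1..n+1. w ^ p * poly_op (g p) (w * dw) * prod_list (map (\<lambda>l. w * dw + of_nat l) [1..<p]))"
proof -
  define E where "E = w * dw"
  have theta: "t * dt = - E" by (simp add: theta_eq E_def)
  have "t * w = 1" by (simp add: w_def)
  hence lead: "(-1) ^ n * ((t * dt) ^ n * t * w) = E ^ n"
    unfolding theta by (simp add: mult.assoc power_minus[of E] minus_one_power_iff)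
  have low: "(-1) ^ n * (poly_op (g p) (t * dt) * dt ^ (p - 1) * w) =
      w ^ p * poly_op (g p) E * prod_list (map (\<lambda>l. E + of_nat l) [1..<p])"
    if p: "p \<in> {1..n+1}" for p
  proof -
    obtain q where q: "p = Suc q" "q \<le> n" using p by (cases p) auto
    define Q where "Q = prod_list (map (\<lambda>l. E + of_nat l) [1..<p])"
    have "dt ^ q * w = (-1) ^ q * ((w^2 * dw) ^ q * w)"
      unfolding dt_eq_dw power_minus[of "w^2 * dw"] by (simp only: mult.assoc)
    also have "(w^2 * dw) ^ q * w = w ^ p * Q"
      unfolding w2_dw_power_w Q_def E_def q ..
    finally have dtw: "dt ^ q * w = (-1) ^ q * (w ^ p * Q)" .
    have "w ^ p * (- E - of_nat p) = - (w ^ p * (E + of_nat p))"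
      by (simp add: algebra_simps)
    also have "\<dots> = - E * w ^ p"
      unfolding E_def euler_w_power[symmetric] by simp
    finally have "w ^ p * poly_op (g p) (- E - of_nat p) = poly_op (g p) (- E) * w ^ p"
      by (rule poly_op_intertwine)
    moreover have "poly_op (g p) E = (-1) ^ (n + 1 - p) * poly_op (g p) (- E - of_nat p)"
      using assms p unfolding symmetric_family_iff_reflect poly_op_reflect[symmetric] by metis
    hence "poly_op (g p) (- E - of_nat p) = (-1) ^ (n + 1 - p) * poly_op (g p) E"
      by (simp add: minus_one_power_iff split: if_splits)
    ultimately have shift: "poly_op (g p) (- E) * w ^ p = (-1) ^ (n + 1 - p) * (w ^ p * poly_op (g p) E)"
      by (metis minus_one_power_commute mult.assoc)
    have "(-1) ^ n * (poly_op (g p) (t * dt) * dt ^ q * w) =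
        (-1) ^ n * (-1) ^ q * (poly_op (g p) (- E) * w ^ p * Q)"
      unfolding theta mult.assoc[of _ "dt ^ q"] dtw by (metis minus_one_power_commute mult.assoc)
    also have "\<dots> = (-1) ^ n * (-1) ^ q * (-1) ^ (n + 1 - p) * (w ^ p * poly_op (g p) E * Q)"
      unfolding shift by (simp only: mult.assoc)
    also have "(-1) ^ n * (-1) ^ q * (-1) ^ (n + 1 - p) = (1 :: diff_op)"
      using q by (auto simp: minus_one_power_iff)
    finally show ?thesis by (simp add: q Q_def del: upt_Suc)
  qed
  show ?thesis
    unfolding normal_form_def distrib_right distrib_left lead sum_distrib_right sum_distrib_left E_def[symmetric]
    by (intro arg_cong2[of _ _ _ _ "(+)"] sum.cong refl low)
qed

lemma type_DN_0_0_eq: "type_DN_0_0 n = {(-1) ^ n * (L * w) | L. L \<in> type_DN_inf_1 n}"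
  unfolding type_DN_0_0_def type_DN_inf_1_def by (force simp: L_zero_eq)

theorem theorem4p11:
  fixes n :: nat
  assumes "n \<ge> 1"
  shows
    "(\<forall>L \<in> type_DN_inf_1 n. dual L = (-1) ^ n * L) \<and>
     type_DN_inf_1 n =
       {(t * dt) ^ n * t + (\<Sum>p=1..n+1. poly_op (g p) (t * dt) * dt ^ (p - 1)) | g.
          symmetric_family n g} \<and>
     (\<forall>L \<in> type_DN_0_0 n. dual L = (-1) ^ n * (w * L * w_inv)) \<and>
     type_DN_0_0 n =
       {(w * dw) ^ n + (\<Sum>p=1..n+1. w ^ p * poly_op (G p) (w * dw) *
                          prod_list (map (\<lambda>l. w * dw + of_nat l) [1..<p])) | G.
          symmetric_family n G}"
proof (intro conjI ballI)
  show "type_DN_inf_1 n =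
       {(t * dt) ^ n * t + (\<Sum>p=1..n+1. poly_op (g p) (t * dt) * dt ^ (p - 1)) | g.
          symmetric_family n g}"
    using type_DN_inf_1_eq unfolding normal_form_def .
  have "type_DN_0_0 n = {(-1) ^ n * (normal_form n g * w) | g. symmetric_family n g}"
    unfolding type_DN_0_0_eq type_DN_inf_1_eq by blast
  also have "\<dots> = {(w * dw) ^ n + (\<Sum>p=1..n+1. w ^ p * poly_op (G p) (w * dw) *
                          prod_list (map (\<lambda>l. w * dw + of_nat l) [1..<p])) | G.
          symmetric_family n G}"
    unfolding setcompr_eq_image
    by (intro image_cong refl) (simp only: mem_Collect_eq symmetric_normal_form_at_w)
  finally show "type_DN_0_0 n = {(w * dw) ^ n + (\<Sum>p=1..n+1. w ^ p * poly_op (G p) (w * dw) *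
                          prod_list (map (\<lambda>l. w * dw + of_nat l) [1..<p])) | G.
          symmetric_family n G}" .
qed (use dual_type_DN_inf_1 dual_type_DN_0_0 in blast)+

end
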